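(* Consider the status updating system described in the context, operating under the randomized highest $k$ selective encoding scheme with parameter $\alpha\in[0,1]$, arrival rate $\lambda>0$, and codeword lengths $\ell(x_1),\dots,\ell(x_n)$. Then the long term average age at the receiver node is $$\Delta_\alpha=\frac{\mathbb{E}[L^2]+\frac{2}{q_{k,\alpha}\lambda}\mathbb{E}[L]+\frac{2}{(q_{k,\alpha}\lambda)^2}}{2\left(\mathbb{E}[L]+\frac{1}{q_{k,\alpha}\lambda}\right)}+\mathbb{E}[L],$$ where $q_{k,\alpha}=\sum_{\ell=1}^kP_X(x_\ell)+\alpha\sum_{\ell=k+1}^nP_X(x_\ell)$, $\mathbb{E}[L]=\sum_{i=1}^nP_{X_\alpha}(x_i)\ell(x_i)$ and $\mathbb{E}[L^2]=\sum_{i=1}^nP_{X_\alpha}(x_i)\ell(x_i)^2$.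
   Context: An information source generates status update packets whose arrival times at a transmitter node form a Poisson process of rate $\lambda>0$. Each packet carries an independent realization of a random variable $X$ taking values in $\{x_1,\dots,x_n\}$ with known pmf $P_X$, where $P_X(x_m)\ge P_X(x_j)$ for all $m\le j$; realizations are independent of the arrival process. Every realization $x_i$ is assigned a binary codeword of length $\ell(x_i)$. Randomized highest $k$ selective encoding with parameter $\alpha\in[0,1]$: when a packet arrives at an idle transmitter, if its realization is $x_i$ with $i\le k$ it is encoded and sent; if $i>k$ it is encoded and sent with probability $\alpha$ and discarded with probability $1-\alpha$ (independently of everything else), in which case the transmitter keeps waiting for the next arrival. Packets arriving while the transmitter is busy are discarded (blocking). Transmission is over an error-free channel at one bit per unit time, so sending $x_i$ takes $\ell(x_i)$ time units, after which the receiver obtains the update and the transmitter becomes idle. Define $q_{k,\alpha}=\sum_{\ell=1}^kP_X(x_\ell)+\alpha\sum_{\ell=k+1}^nP_X(x_\ell)$ and $P_{X_\alpha}(x_i)=P_X(x_i)/q_{k,\alpha}$ for $i\le k$, $P_{X_\alpha}(x_i)=\alpha P_X(x_i)/q_{k,\alpha}$ for $i>k$. The instantaneous age at the receiver is $\Delta(t)=t-u(t)$, where $u(t)$ is the generation (arrival) time of the most recently received update, and the long term average age is $\lim_{T\to\infty}\frac1T\int_0^T\Delta(t)\,dt$. *)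

theory Defs
  imports "HOL-Probability.Probability"
begin

text \<open>Sample path: for each packet index j (j = 0,1,2,...), the triple
  (interarrival time before packet j, realization index i of packet j, coin of packet j).
  Realization x_i is identified with its index i in {1..n}.\<close>

type_synonym sample = "nat \<Rightarrow> real \<times> nat \<times> bool"

text \<open>Probability space: i.i.d. triples, components independent: Exp(lambda) interarrival
  times (so arrivals form a Poisson process of rate lambda), marks with pmf p, and
  Bernoulli(alpha) coins used for the randomized decision.\<close>
definition sys_space :: "real \<Rightarrow> nat pmf \<Rightarrow> real \<Rightarrow> sample measure" where
  "sys_space lam p \<alpha> =
     PiM UNIV (\<lambda>_. density lborel (exponential_density lam)
                   \<Otimes>\<^sub>M (measure_pmf p \<Otimes>\<^sub>M measure_pmf (bernoulli_pmf \<alpha>)))"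

definition arr :: "sample \<Rightarrow> nat \<Rightarrow> real" where
  "arr \<omega> j = (\<Sum>i\<le>j. fst (\<omega> i))"

definition mark :: "sample \<Rightarrow> nat \<Rightarrow> nat" where
  "mark \<omega> j = fst (snd (\<omega> j))"

definition coin :: "sample \<Rightarrow> nat \<Rightarrow> bool" where
  "coin \<omega> j = snd (snd (\<omega> j))"

definition wants :: "nat \<Rightarrow> sample \<Rightarrow> nat \<Rightarrow> bool" where
  "wants k \<omega> j = (mark \<omega> j \<le> k \<or> coin \<omega> j)"

text \<open>Time until which the transmitter is busy, after handling packets 0..j-1.\<close>
fun busy :: "nat \<Rightarrow> (nat \<Rightarrow> nat) \<Rightarrow> sample \<Rightarrow> nat \<Rightarrow> real" where
  "busy k len \<omega> 0 = 0"
| "busy k len \<omega> (Suc j) =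
     (if busy k len \<omega> j \<le> arr \<omega> j \<and> wants k \<omega> j
      then arr \<omega> j + real (len (mark \<omega> j)) else busy k len \<omega> j)"

definition sent :: "nat \<Rightarrow> (nat \<Rightarrow> nat) \<Rightarrow> sample \<Rightarrow> nat \<Rightarrow> bool" where
  "sent k len \<omega> j = (busy k len \<omega> j \<le> arr \<omega> j \<and> wants k \<omega> j)"

text \<open>Generation time of the most recently received update (0 before any delivery,
  i.e. the system starts at time 0 with age 0).\<close>
definition last_gen :: "nat \<Rightarrow> (nat \<Rightarrow> nat) \<Rightarrow> sample \<Rightarrow> real \<Rightarrow> real" where
  "last_gen k len \<omega> t =
     Sup (insert 0 {arr \<omega> j | j. sent k len \<omega> j \<and> arr \<omega> j + real (len (mark \<omega> j)) \<le> t})"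

definition age :: "nat \<Rightarrow> (nat \<Rightarrow> nat) \<Rightarrow> sample \<Rightarrow> real \<Rightarrow> real" where
  "age k len \<omega> t = t - last_gen k len \<omega> t"

definition q_ka :: "nat pmf \<Rightarrow> nat \<Rightarrow> nat \<Rightarrow> real \<Rightarrow> real" where
  "q_ka p n k \<alpha> = (\<Sum>i=1..k. pmf p i) + \<alpha> * (\<Sum>i=k+1..n. pmf p i)"

definition P_Xa :: "nat pmf \<Rightarrow> nat \<Rightarrow> nat \<Rightarrow> real \<Rightarrow> nat \<Rightarrow> real" where
  "P_Xa p n k \<alpha> i = (if i \<le> k then pmf p i else \<alpha> * pmf p i) / q_ka p n k \<alpha>"

definition EL :: "nat pmf \<Rightarrow> nat \<Rightarrow> nat \<Rightarrow> real \<Rightarrow> (nat \<Rightarrow> nat) \<Rightarrow> real" where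
  "EL p n k \<alpha> len = (\<Sum>i=1..n. P_Xa p n k \<alpha> i * real (len i))"

definition EL2 :: "nat pmf \<Rightarrow> nat \<Rightarrow> nat \<Rightarrow> real \<Rightarrow> (nat \<Rightarrow> nat) \<Rightarrow> real" where
  "EL2 p n k \<alpha> len = (\<Sum>i=1..n. P_Xa p n k \<alpha> i * real (len i) ^ 2)"

end

theory Submission
  imports Defs "HOL-Library.Discrete_Functions"
begin

text \<open>
  Instead of splitting time into renewal cycles, follow the system from one arriving packet to the
  next. With \<open>X j\<close> the later of the \<open>(j-1)\<close>-st arrival and the end of the current transmission, the
  integral of the age over \<open>[X j, X (j+1)]\<close> is an explicit function of the state \<open>(R, v)\<close> (residual busy
  time, age at \<open>X j\<close>) and of the packet \<open>j\<close>. By memorylessness of the gaps,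
  \<open>area increment - \<Delta> * clock increment + \<gamma> * (increment of v)\<close>
  has conditional mean zero given the past for suitable constants \<open>\<gamma>\<close> and \<open>\<Delta>\<close>, and \<open>\<Delta>\<close> is the claimed
  average age. These martingale differences have bounded second moments because \<open>v\<close> has, so their
  averages tend to 0 almost surely. As \<open>v j / j\<close> tends to 0 and \<open>X j / j\<close> to \<open>1 / lam\<close>, the age has
  average \<open>\<Delta>\<close> along the times \<open>X j\<close>; monotonicity of the integral extends this to all times.
\<close>

section \<open>A strong law for orthogonal sequences\<close>

text \<open>By monotone convergence the series of the \<open>X m\<close> has finite integral, so it
  converges almost surely and its terms vanish. This does the work of Chebyshev plus
  Borel-Cantelli.\<close>

lemma AE_tendsto_zero_if_summable_integrals:
  fixes X :: "nat \<Rightarrow> 'a \<Rightarrow> real" and c :: "nat \<Rightarrow> real"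
  assumes meas [measurable]: "\<And>m. X m \<in> borel_measurable M"
    and nonneg: "\<And>m \<omega>. 0 \<le> X m \<omega>"
    and bound: "\<And>m. (\<integral>\<^sup>+\<omega>. X m \<omega> \<partial>M) \<le> ennreal (c m)"
    and c: "summable c" "\<And>m. 0 \<le> c m"
  shows "AE \<omega> in M. (\<lambda>m. X m \<omega>) \<longlonglongrightarrow> 0"
proof -
  have "(\<integral>\<^sup>+\<omega>. (\<Sum>m. ennreal (X m \<omega>)) \<partial>M) = (\<Sum>m. \<integral>\<^sup>+\<omega>. X m \<omega> \<partial>M)"
    by (rule nn_integral_suminf) simp
  also have "\<dots> \<le> (\<Sum>m. ennreal (c m))"
    by (intro suminf_le bound) auto
  also have "\<dots> = ennreal (suminf c)"
    by (intro suminf_ennreal2 c)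
  finally have "(\<integral>\<^sup>+\<omega>. (\<Sum>m. ennreal (X m \<omega>)) \<partial>M) < \<infinity>"
    using ennreal_less_top le_less_trans by (metis infinity_ennreal_def)
  then have "AE \<omega> in M. (\<Sum>m. ennreal (X m \<omega>)) \<noteq> \<infinity>"
    by (intro nn_integral_PInf_AE) auto
  then show ?thesis
  proof eventually_elim
    case (elim \<omega>)
    then have "summable (\<lambda>m. X m \<omega>)"
      by (intro summable_suminf_not_top) (auto simp: nonneg)
    then show ?case
      by (rule summable_LIMSEQ_zero)
  qed
qed

lemma integrable_mult_of_squares:
  fixes f g :: "'a \<Rightarrow> real"
  assumes [measurable]: "f \<in> borel_measurable M" "g \<in> borel_measurable M"
    and "integrable M (\<lambda>x. (f x)\<^sup>2)" "integrable M (\<lambda>x. (g x)\<^sup>2)"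
  shows "integrable M (\<lambda>x. f x * g x)"
proof (rule Bochner_Integration.integrable_bound)
  show "integrable M (\<lambda>x. (f x)\<^sup>2 + (g x)\<^sup>2)"
    using assms by simp
  have "\<bar>f x * g x\<bar> \<le> (f x)\<^sup>2 + (g x)\<^sup>2" for x
    using sum_squares_bound[of "\<bar>f x\<bar>" "\<bar>g x\<bar>"] abs_ge_zero[of "f x * g x"]
    unfolding abs_mult power2_abs by linarith
  then show "AE x in M. norm (f x * g x) \<le> norm ((f x)\<^sup>2 + (g x)\<^sup>2)"
    by (auto intro: order_trans[OF _ abs_ge_self])
qed simp

text \<open>Along squares \<open>m\<^sup>2\<close> the variance of the mean is \<open>O(1/m\<^sup>2)\<close>, hence summable. Between \<open>m\<^sup>2\<close> and \<open>(m+1)\<^sup>2\<close>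
  there are only \<open>2m+1\<close> terms, so Cauchy-Schwarz alone controls the fluctuation.\<close>

theorem strong_law_orthogonal:
  fixes D :: "nat \<Rightarrow> 'a \<Rightarrow> real"
  assumes meas [measurable]: "\<And>j. D j \<in> borel_measurable M"
    and bound: "\<And>j. (\<integral>\<^sup>+\<omega>. ennreal ((D j \<omega>)\<^sup>2) \<partial>M) \<le> ennreal K"
    and orth: "\<And>i j. i < j \<Longrightarrow> (\<integral>\<omega>. D i \<omega> * D j \<omega> \<partial>M) = 0"
  shows "AE \<omega> in M. (\<lambda>n. (\<Sum>j<n. D j \<omega>) / real n) \<longlonglongrightarrow> 0"
proof -
  \<comment> \<open>\<open>ennreal\<close> sends negative reals to 0, so truncating the constant
    keeps the bound and makes it usable in real inequalities.\<close>
  define K' where "K' = max 0 K"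
  have K': "0 \<le> K'" "ennreal K \<le> ennreal K'" by (auto simp: K'_def intro: ennreal_leI)
  have sq: "integrable M (\<lambda>\<omega>. (D j \<omega>)\<^sup>2)" for j
    using bound[of j] by (intro integrableI_nonneg) (auto intro: le_less_trans)
  have prod: "integrable M (\<lambda>\<omega>. D i \<omega> * D j \<omega>)" for i j
    by (intro integrable_mult_of_squares sq) auto
  have sqle: "(\<integral>\<omega>. (D j \<omega>)\<^sup>2 \<partial>M) \<le> K'" for j
  proof -
    have "ennreal (\<integral>\<omega>. (D j \<omega>)\<^sup>2 \<partial>M) \<le> ennreal K'"
      using order_trans[OF bound[of j] K'(2)] sq[of j]
      by (subst nn_integral_eq_integral[symmetric]) auto
    then show ?thesis using K' by simp
  qed
  have orth': "(\<integral>\<omega>. D i \<omega> * D j \<omega> \<partial>M) = (if i = j then (\<integral>\<omega>. (D j \<omega>)\<^sup>2 \<partial>M) else 0)" for i j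
    using orth[of i j] orth[of j i] by (cases i j rule: linorder_cases) (auto simp: power2_eq_square mult.commute)
  define S where "S n \<omega> = (\<Sum>j<n. D j \<omega>)" for n \<omega>
  have S_sq: "(S n \<omega>)\<^sup>2 = (\<Sum>i<n. \<Sum>j<n. D i \<omega> * D j \<omega>)" for n \<omega>
    by (simp add: S_def power2_eq_square sum_product)
  have int_S: "integrable M (\<lambda>\<omega>. (S n \<omega>)\<^sup>2)" for n
    unfolding S_sq by (intro Bochner_Integration.integrable_sum prod)
  have ES: "(\<integral>\<omega>. (S n \<omega>)\<^sup>2 \<partial>M) \<le> real n * K'" for n
  proof -
    have "(\<integral>\<omega>. (S n \<omega>)\<^sup>2 \<partial>M) = (\<Sum>i<n. \<Sum>j<n. \<integral>\<omega>. D i \<omega> * D j \<omega> \<partial>M)"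
      unfolding S_sq by (simp add: prod)
    also have "\<dots> = (\<Sum>i<n. \<integral>\<omega>. (D i \<omega>)\<^sup>2 \<partial>M)"
      by (simp add: orth')
    also have "\<dots> \<le> (\<Sum>i<n. K')"
      by (intro sum_mono sqle)
    finally show ?thesis by simp
  qed
  \<comment> \<open>Dominates every partial sum of \<open>D\<close> over an initial piece of the
    block, wherever that piece ends.\<close>
  define H where "H m \<omega> = (\<Sum>j\<in>{m\<^sup>2..<(Suc m)\<^sup>2}. \<bar>D j \<omega>\<bar>)" for m \<omega>
  have H_sq: "(H m \<omega>)\<^sup>2 \<le> real (2 * m + 1) * (\<Sum>j\<in>{m\<^sup>2..<(Suc m)\<^sup>2}. (D j \<omega>)\<^sup>2)" for m \<omega>
  proof -
    have "(Suc m)\<^sup>2 - m\<^sup>2 = 2 * m + 1"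
      by (simp add: power2_eq_square)
    then show ?thesis
      using sum_squared_le_sum_of_squares[of "\<lambda>j. \<bar>D j \<omega>\<bar>" "{m\<^sup>2..<(Suc m)\<^sup>2}"]
      by (simp add: H_def mult.commute)
  qed
  have int_H: "integrable M (\<lambda>\<omega>. (H m \<omega>)\<^sup>2)" for m
    by (rule Bochner_Integration.integrable_bound[where f="\<lambda>\<omega>. real (2 * m + 1) * (\<Sum>j\<in>{m\<^sup>2..<(Suc m)\<^sup>2}. (D j \<omega>)\<^sup>2)"])
      (use H_sq in \<open>auto simp: H_def sq intro!: AE_I2 order_trans[OF _ abs_ge_self]\<close>)
  have EH: "(\<integral>\<omega>. (H m \<omega>)\<^sup>2 \<partial>M) \<le> (real (2 * m + 1))\<^sup>2 * K'" for m
  proof -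
    have card: "(Suc m)\<^sup>2 - m\<^sup>2 = 2 * m + 1"
      by (simp add: power2_eq_square)
    have "(\<integral>\<omega>. (H m \<omega>)\<^sup>2 \<partial>M) \<le> (\<integral>\<omega>. real (2 * m + 1) * (\<Sum>j\<in>{m\<^sup>2..<(Suc m)\<^sup>2}. (D j \<omega>)\<^sup>2) \<partial>M)"
      by (intro integral_mono int_H H_sq) (auto simp: sq)
    also have "\<dots> = real (2 * m + 1) * (\<Sum>j\<in>{m\<^sup>2..<(Suc m)\<^sup>2}. \<integral>\<omega>. (D j \<omega>)\<^sup>2 \<partial>M)"
      by (simp add: sq)
    also have "\<dots> \<le> real (2 * m + 1) * (\<Sum>j\<in>{m\<^sup>2..<(Suc m)\<^sup>2}. K')"
      by (intro mult_left_mono sum_mono sqle) auto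
    also have "\<dots> = (real (2 * m + 1))\<^sup>2 * K'"
      unfolding sum_constant card_atLeastLessThan card by (simp add: power2_eq_square)
    finally show ?thesis .
  qed
  \<comment> \<open>The denominator is the square of the sample size \<open>m\<^sup>2\<close>. At
    \<open>m = 0\<close> division by zero makes \<open>F\<close> vanish.\<close>
  define F where "F m \<omega> = ((S (m\<^sup>2) \<omega>)\<^sup>2 + (H m \<omega>)\<^sup>2) / real m ^ 4" for m \<omega>
  have [measurable]: "F m \<in> borel_measurable M" for m
    unfolding F_def S_def H_def by measurable
  have F_nonneg: "0 \<le> F m \<omega>" for m \<omega>
    by (simp add: F_def)
  \<comment> \<open>The factor 10 is \<open>1 + 3\<^sup>2\<close>: one from the partial sum, nine
    from the block via \<open>2 * m + 1 \<le> 3 * m\<close>.\<close>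
  have EF: "(\<integral>\<^sup>+\<omega>. F m \<omega> \<partial>M) \<le> ennreal (10 * K' * inverse (real m ^ 2))" for m
  proof (cases "m = 0")
    case True
    then show ?thesis by (simp add: F_def)
  next
    case False
    have "integrable M (F m)"
      unfolding F_def by (auto simp: int_S int_H)
    then have "(\<integral>\<^sup>+\<omega>. F m \<omega> \<partial>M) = ennreal (\<integral>\<omega>. F m \<omega> \<partial>M)"
      by (rule nn_integral_eq_integral) (simp add: F_def)
    also have "(\<integral>\<omega>. F m \<omega> \<partial>M) = ((\<integral>\<omega>. (S (m\<^sup>2) \<omega>)\<^sup>2 \<partial>M) + (\<integral>\<omega>. (H m \<omega>)\<^sup>2 \<partial>M)) / real m ^ 4"
      by (simp add: F_def int_S int_H)
    also have "\<dots> \<le> (real (m\<^sup>2) * K' + (real (2 * m + 1))\<^sup>2 * K') / real m ^ 4"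
      by (intro divide_right_mono add_mono ES EH) auto
    also have "\<dots> \<le> (real (m\<^sup>2) * K' + (3 * real m)\<^sup>2 * K') / real m ^ 4"
      using False K' by (intro divide_right_mono add_left_mono mult_right_mono power_mono) auto
    also have "\<dots> = 10 * K' * inverse (real m ^ 2)"
      using False by (simp add: field_simps power2_eq_square power4_eq_xxxx)
    finally show ?thesis by (simp add: ennreal_leI)
  qed
  have "AE \<omega> in M. (\<lambda>m. F m \<omega>) \<longlonglongrightarrow> 0"
    using EF K' by (intro AE_tendsto_zero_if_summable_integrals[where c="\<lambda>m. 10 * K' * inverse (real m ^ 2)"]
        summable_mult inverse_power_summable F_nonneg) auto
  then show ?thesis
  proof eventually_elim
    case (elim \<omega>)
    have "filterlim floor_sqrt at_top at_top"
      unfolding filterlim_at_top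
    proof
      fix Z :: nat
      show "\<forall>\<^sub>F x in sequentially. Z \<le> floor_sqrt x"
        using eventually_ge_at_top[of "Z\<^sup>2"]
        by eventually_elim (metis floor_sqrt_inverse_power2 monoD mono_floor_sqrt)
    qed
    then have "(\<lambda>n. F (floor_sqrt n) \<omega>) \<longlonglongrightarrow> 0"
      using elim filterlim_compose by blast
    then have "(\<lambda>n. sqrt (2 * F (floor_sqrt n) \<omega>)) \<longlonglongrightarrow> sqrt (2 * 0)"
      by (intro tendsto_intros)
    then have lim: "(\<lambda>n. sqrt (2 * F (floor_sqrt n) \<omega>)) \<longlonglongrightarrow> 0" by simp
    \<comment> \<open>The sum splits at the largest square below or equal to \<open>n\<close>; the
      factor 2 comes from \<open>(x + y)\<^sup>2 \<le> 2 * (x\<^sup>2 + y\<^sup>2)\<close>.\<close>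
    have "norm ((\<Sum>j<n. D j \<omega>) / real n) \<le> sqrt (2 * F (floor_sqrt n) \<omega>)" if "n > 0" for n
    proof -
      define m where "m = floor_sqrt n"
      have m: "m\<^sup>2 \<le> n" "n < (Suc m)\<^sup>2" "m > 0"
        using that Suc_floor_sqrt_power2_gt[of n] by (auto simp: m_def)
      have "{..<n} = {..<m\<^sup>2} \<union> {m\<^sup>2..<n}" using m by auto
      then have "(\<Sum>j<n. D j \<omega>) = S (m\<^sup>2) \<omega> + (\<Sum>j\<in>{m\<^sup>2..<n}. D j \<omega>)"
        by (simp add: S_def sum.union_disjoint ivl_disj_int)
      moreover have "\<bar>\<Sum>j\<in>{m\<^sup>2..<n}. D j \<omega>\<bar> \<le> H m \<omega>"
        unfolding H_def using m by (intro order_trans[OF sum_abs] sum_mono2) auto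
      ultimately have "\<bar>\<Sum>j<n. D j \<omega>\<bar> \<le> \<bar>S (m\<^sup>2) \<omega>\<bar> + H m \<omega>" by linarith
      then have "\<bar>\<Sum>j<n. D j \<omega>\<bar> / real n \<le> (\<bar>S (m\<^sup>2) \<omega>\<bar> + H m \<omega>) / real (m\<^sup>2)"
        using m that by (intro frac_le) (auto simp: H_def intro!: add_nonneg_nonneg sum_nonneg simp del: of_nat_power)
      also have "\<dots> \<le> sqrt (2 * F m \<omega>)"
      proof (rule real_le_rsqrt)
        have "(\<bar>S (m\<^sup>2) \<omega>\<bar> + H m \<omega>)\<^sup>2 \<le> 2 * ((S (m\<^sup>2) \<omega>)\<^sup>2 + (H m \<omega>)\<^sup>2)"
          using sum_squares_bound[of "\<bar>S (m\<^sup>2) \<omega>\<bar>" "H m \<omega>"] by (simp add: power2_sum)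
        then show "((\<bar>S (m\<^sup>2) \<omega>\<bar> + H m \<omega>) / real (m\<^sup>2))\<^sup>2 \<le> 2 * F m \<omega>"
          by (simp add: F_def power_divide divide_right_mono flip: power_mult)
      qed
      finally show ?thesis by (simp add: m_def)
    qed
    then show ?case
      by (intro Lim_null_comparison[OF _ lim] eventually_sequentiallyI[of 1]) auto
  qed
qed

section \<open>Martingale differences on a product space\<close>

text \<open>Integrating out the coordinate \<open>j\<close> plays the role of conditioning on all the others.\<close>

lemma distr_fun_upd_PiM:
  assumes "prob_space M"
  shows "distr (M \<Otimes>\<^sub>M PiM UNIV (\<lambda>_. M)) (PiM UNIV (\<lambda>_. M)) (\<lambda>(x, \<omega>). fun_upd \<omega> j x) = PiM UNIV (\<lambda>_::'i. M)"
  using distr_pair_PiM_eq_PiM[of UNIV "\<lambda>_. M" j] assms by simp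

lemma measurable_fun_upd_PiM [measurable]:
  "(\<lambda>(x, \<omega>). fun_upd \<omega> j x) \<in> M \<Otimes>\<^sub>M PiM UNIV (\<lambda>_. M) \<rightarrow>\<^sub>M PiM UNIV (\<lambda>_. M)"
  unfolding split_beta by (rule measurable_fun_upd[where J=UNIV]) auto

text \<open>A fresh independent value in coordinate \<open>j\<close> leaves the product law
  unchanged, and Tonelli allows integrating over that value first.\<close>

lemma nn_integral_resample:
  assumes M: "prob_space M" and [measurable]: "f \<in> borel_measurable (PiM UNIV (\<lambda>_. M))"
  shows "(\<integral>\<^sup>+\<omega>. f \<omega> \<partial>PiM UNIV (\<lambda>_. M)) = (\<integral>\<^sup>+\<omega>. \<integral>\<^sup>+x. f (fun_upd \<omega> j x) \<partial>M \<partial>PiM UNIV (\<lambda>_. M))"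
proof -
  interpret M: prob_space M by fact
  interpret P: prob_space "PiM UNIV (\<lambda>_. M)" by (intro prob_space_PiM M)
  interpret pair_sigma_finite M "PiM UNIV (\<lambda>_. M)" ..
  have "(\<integral>\<^sup>+\<omega>. f \<omega> \<partial>PiM UNIV (\<lambda>_. M))
      = (\<integral>\<^sup>+z. f (case z of (x, \<omega>) \<Rightarrow> fun_upd \<omega> j x) \<partial>(M \<Otimes>\<^sub>M PiM UNIV (\<lambda>_. M)))"
    by (subst distr_fun_upd_PiM[OF M, of j, symmetric]) (simp add: nn_integral_distr)
  then show ?thesis
    by (subst (asm) nn_integral_snd[symmetric]) auto
qed

lemma integral_resample:
  fixes f :: "('i \<Rightarrow> 'a) \<Rightarrow> real"
  assumes M: "prob_space M" and f: "integrable (PiM UNIV (\<lambda>_. M)) f"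
  shows "(\<integral>\<omega>. f \<omega> \<partial>PiM UNIV (\<lambda>_. M)) = (\<integral>\<omega>. \<integral>x. f (fun_upd \<omega> j x) \<partial>M \<partial>PiM UNIV (\<lambda>_. M))"
proof -
  interpret M: prob_space M by fact
  interpret P: prob_space "PiM UNIV (\<lambda>_::'i. M)" by (intro prob_space_PiM M)
  interpret pair_sigma_finite M "PiM UNIV (\<lambda>_::'i. M)" ..
  have [measurable]: "f \<in> borel_measurable (PiM UNIV (\<lambda>_. M))"
    using f by simp
  have "integrable (distr (M \<Otimes>\<^sub>M PiM UNIV (\<lambda>_. M)) (PiM UNIV (\<lambda>_. M)) (\<lambda>(x, \<omega>). fun_upd \<omega> j x)) f"
    using f by (simp add: distr_fun_upd_PiM[OF M])
  then have int: "integrable (M \<Otimes>\<^sub>M PiM UNIV (\<lambda>_. M)) (\<lambda>(x, \<omega>). f (fun_upd \<omega> j x))"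
    by (subst (asm) integrable_distr_eq) (auto simp: case_prod_unfold)
  have "(\<integral>\<omega>. f \<omega> \<partial>PiM UNIV (\<lambda>_. M))
      = (\<integral>z. f (case z of (x, \<omega>) \<Rightarrow> fun_upd \<omega> j x) \<partial>(M \<Otimes>\<^sub>M PiM UNIV (\<lambda>_. M)))"
    by (subst distr_fun_upd_PiM[OF M, of j, symmetric]) (simp add: integral_distr)
  also have "\<dots> = (\<integral>(x, \<omega>). f (fun_upd \<omega> j x) \<partial>(M \<Otimes>\<^sub>M PiM UNIV (\<lambda>_. M)))"
    by (simp add: case_prod_unfold)
  finally show ?thesis
    using integral_snd[OF int] by simp
qed

text \<open>Resampling coordinate \<open>j\<close> does not affect \<open>D i\<close> for
  \<open>i < j\<close>, so \<open>D i\<close> leaves the inner integral, and the remaining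
  conditional mean of \<open>D j\<close> is 0. This gives the orthogonality needed for
  \<open>strong_law_orthogonal\<close>.\<close>

theorem strong_law_martingale_differences:
  fixes D :: "nat \<Rightarrow> (nat \<Rightarrow> 'a) \<Rightarrow> real"
  assumes M: "prob_space M"
    and meas [measurable]: "\<And>j. D j \<in> borel_measurable (PiM UNIV (\<lambda>_. M))"
    and adapted: "\<And>i j \<omega> x. i < j \<Longrightarrow> D i (fun_upd \<omega> j x) = D i \<omega>"
    and centered: "\<And>j. AE \<omega> in PiM UNIV (\<lambda>_. M). (\<integral>x. D j (fun_upd \<omega> j x) \<partial>M) = 0"
    and bound: "\<And>j. (\<integral>\<^sup>+\<omega>. ennreal ((D j \<omega>)\<^sup>2) \<partial>PiM UNIV (\<lambda>_. M)) \<le> ennreal K"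
  shows "AE \<omega> in PiM UNIV (\<lambda>_. M). (\<lambda>n. (\<Sum>j<n. D j \<omega>) / real n) \<longlonglongrightarrow> 0"
proof (rule strong_law_orthogonal[OF meas bound])
  fix i j :: nat assume "i < j"
  have sq: "integrable (PiM UNIV (\<lambda>_. M)) (\<lambda>\<omega>. (D j \<omega>)\<^sup>2)" for j
    using bound[of j] by (intro integrableI_nonneg) (auto intro: le_less_trans)
  have "(\<integral>\<omega>. D i \<omega> * D j \<omega> \<partial>PiM UNIV (\<lambda>_. M))
      = (\<integral>\<omega>. \<integral>x. D i (fun_upd \<omega> j x) * D j (fun_upd \<omega> j x) \<partial>M \<partial>PiM UNIV (\<lambda>_. M))"
    by (intro integral_resample[OF M] integrable_mult_of_squares sq) auto
  also have "\<dots> = (\<integral>\<omega>. D i \<omega> * (\<integral>x. D j (fun_upd \<omega> j x) \<partial>M) \<partial>PiM UNIV (\<lambda>_. M))"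
    using \<open>i < j\<close> by (simp add: adapted)
  also have "\<dots> = 0"
    by (rule integral_eq_zero_AE) (use centered[of j] in \<open>auto elim: eventually_mono\<close>)
  finally show "(\<integral>\<omega>. D i \<omega> * D j \<omega> \<partial>PiM UNIV (\<lambda>_. M)) = 0" .
qed

lemma has_bochner_integral_pair_mult:
  fixes f :: "'a \<Rightarrow> real" and g :: "'b \<Rightarrow> real"
  assumes "sigma_finite_measure M" "sigma_finite_measure N"
    and f: "has_bochner_integral M f a" and g: "has_bochner_integral N g b"
  shows "has_bochner_integral (M \<Otimes>\<^sub>M N) (\<lambda>x. f (fst x) * g (snd x)) (a * b)"
proof -
  interpret M: sigma_finite_measure M by fact
  interpret N: sigma_finite_measure N by fact
  interpret pair_sigma_finite M N ..
  have fi: "integrable M f" "integral\<^sup>L M f = a" and gi: "integrable N g" "integral\<^sup>L N g = b"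
    using f g by (auto simp: has_bochner_integral_iff)
  then have [measurable]: "f \<in> borel_measurable M" "g \<in> borel_measurable N" by auto
  have int: "integrable (M \<Otimes>\<^sub>M N) (\<lambda>x. f (fst x) * g (snd x))"
  proof (rule Fubini_integrable)
    show "integrable M (\<lambda>x. \<integral>y. norm (f (fst (x, y)) * g (snd (x, y))) \<partial>N)"
      using fi by (simp add: abs_mult)
  qed (auto simp: gi)
  then have "(\<integral>x. f (fst x) * g (snd x) \<partial>(M \<Otimes>\<^sub>M N)) = a * b"
    by (subst integral_fst'[symmetric]) (auto simp: fi gi)
  then show ?thesis using int by (simp add: has_bochner_integral_iff)
qed

section \<open>The age on a sample path\<close>

text \<open>For \<open>T\<close> between two consecutive points of the sequence, monotonicity
  squeezes \<open>f T / T\<close> between \<open>f (x n) / x (Suc n)\<close> and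
  \<open>f (x (Suc n)) / x n\<close>. Both tend to \<open>d\<close>, because the index shift only
  costs a factor tending to 1.\<close>

lemma tendsto_ratio_at_top_of_sequence:
  fixes f :: "real \<Rightarrow> real" and x :: "nat \<Rightarrow> real"
  assumes mono: "\<And>s t. 0 \<le> s \<Longrightarrow> s \<le> t \<Longrightarrow> f s \<le> f t" and nonneg: "\<And>t. 0 \<le> t \<Longrightarrow> 0 \<le> f t"
    and x: "x 0 = 0" "incseq x" "(\<lambda>n. x n / real n) \<longlonglongrightarrow> c" "c > 0"
    and fx: "(\<lambda>n. f (x n) / real n) \<longlonglongrightarrow> d * c"
  shows "((\<lambda>T. f T / T) \<longlongrightarrow> d) at_top"
proof -
  have x_nonneg: "0 \<le> x n" for n
    using incseqD[OF x(2), of 0 n] x(1) by simp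
  have Suc_ratio: "(\<lambda>n. real (Suc n) / real n) \<longlonglongrightarrow> 1"
    using LIMSEQ_Suc_n_over_n by simp
  have lower: "(\<lambda>n. f (x n) / x (Suc n)) \<longlonglongrightarrow> d"
  proof -
    have "(\<lambda>n. (f (x n) / real n) / ((x (Suc n) / real (Suc n)) * (real (Suc n) / real n))) \<longlonglongrightarrow> d * c / (c * 1)"
      using x(4) by (intro tendsto_intros fx LIMSEQ_Suc[OF x(3)] Suc_ratio) auto
    moreover have "\<forall>\<^sub>F n in sequentially. (f (x n) / real n) / ((x (Suc n) / real (Suc n)) * (real (Suc n) / real n)) = f (x n) / x (Suc n)"
      by (intro eventually_sequentiallyI[of 1]) (simp del: of_nat_Suc)
    ultimately have "(\<lambda>n. f (x n) / x (Suc n)) \<longlonglongrightarrow> d * c / (c * 1)"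
      by (rule Lim_transform_eventually)
    then show ?thesis using x(4) by simp
  qed
  have upper: "(\<lambda>n. f (x (Suc n)) / x n) \<longlonglongrightarrow> d"
  proof -
    have "(\<lambda>n. (f (x (Suc n)) / real (Suc n)) * (real (Suc n) / real n) / (x n / real n)) \<longlonglongrightarrow> (d * c) * 1 / c"
      using x(4) by (intro tendsto_intros LIMSEQ_Suc[OF fx] x(3) Suc_ratio) auto
    moreover have "\<forall>\<^sub>F n in sequentially. (f (x (Suc n)) / real (Suc n)) * (real (Suc n) / real n) / (x n / real n) = f (x (Suc n)) / x n"
      by (intro eventually_sequentiallyI[of 1]) (simp del: of_nat_Suc)
    ultimately have "(\<lambda>n. f (x (Suc n)) / x n) \<longlonglongrightarrow> (d * c) * 1 / c"
      by (rule Lim_transform_eventually)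
    then show ?thesis using x(4) by simp
  qed
  have x_top: "filterlim x at_top sequentially"
  proof -
    have "filterlim (\<lambda>n. (x n / real n) * real n) at_top sequentially"
      by (rule filterlim_tendsto_pos_mult_at_top[OF x(3,4) filterlim_real_sequentially])
    moreover have "\<forall>\<^sub>F n in sequentially. (x n / real n) * real n = x n"
      by (intro eventually_sequentiallyI[of 1]) auto
    ultimately show ?thesis by (simp add: filterlim_cong)
  qed
  \<comment> \<open>For \<open>0 \<le> T\<close> this index satisfies
    \<open>x (N T) \<le> T < x (Suc (N T))\<close>; the lower bound at index 0 uses
    \<open>x 0 = 0\<close>.\<close>
  define N where "N T = (LEAST n. T < x (Suc n))" for T
  have ex: "\<exists>n. T < x (Suc n)" for T
  proof -
    have "\<forall>\<^sub>F n in sequentially. T < x (Suc n)"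
      using filterlim_Suc x_top by (metis filterlim_at_top_dense filterlim_compose)
    then show ?thesis using eventually_happens by force
  qed
  have N_less: "T < x (Suc (N T))" for T
    unfolding N_def by (rule LeastI_ex[OF ex])
  have N_le: "x (N T) \<le> T" if "0 \<le> T" for T
  proof (cases "N T")
    case (Suc m)
    then have "\<not> T < x (Suc m)"
      unfolding N_def by (intro not_less_Least) auto
    then show ?thesis using Suc by simp
  qed (use that x(1) in simp)
  have N_top: "filterlim N at_top at_top"
    unfolding filterlim_at_top
  proof
    fix Z
    show "\<forall>\<^sub>F T in at_top. Z \<le> N T"
      using eventually_ge_at_top[of "x Z"]
    proof eventually_elim
      case (elim T)
      show ?case
      proof (rule ccontr)
        assume "\<not> Z \<le> N T"
        then have "x (Suc (N T)) \<le> x Z"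
          by (intro incseqD[OF x(2)]) auto
        then show False using N_less[of T] elim by simp
      qed
    qed
  qed
  show ?thesis
  proof (rule tendsto_sandwich[OF _ _ filterlim_compose[OF lower N_top] filterlim_compose[OF upper N_top]])
    show "\<forall>\<^sub>F T in at_top. f (x (N T)) / x (Suc (N T)) \<le> f T / T"
      using eventually_gt_at_top[of 0]
    proof eventually_elim
      case (elim T)
      then show ?case
        using N_less[of T] N_le[of T] x_nonneg[of "N T"]
        by (intro frac_le mono nonneg) auto
    qed
    have "\<forall>\<^sub>F n in sequentially. 0 < x n"
      using x_top by (simp add: filterlim_at_top_dense)
    then have "\<forall>\<^sub>F T in at_top. 0 < x (N T)"
      by (rule eventually_compose_filterlim[OF _ N_top])
    then show "\<forall>\<^sub>F T in at_top. f T / T \<le> f (x (Suc (N T))) / x (N T)"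
      using eventually_gt_at_top[of 0]
    proof eventually_elim
      case (elim T)
      then show ?case
        using N_less[of T] N_le[of T] x_nonneg[of "Suc (N T)"]
        by (intro frac_le mono nonneg) auto
    qed
  qed
qed

text \<open>Seen from packet \<open>j\<close>, let \<open>X\<close> be the maximum of the previous arrival time and \<open>busy\<close>. The state is
  \<open>(R, v)\<close>, where \<open>R\<close> is \<open>X\<close> minus the previous arrival time (the residual busy time) and \<open>v\<close> is the age
  at time \<open>X\<close>, when everything sent so far has been delivered. The \<open>clock\<close> below is \<open>X\<close>. Starting with
  age 0 amounts to an instantaneous delivery at time 0, hence the initial state \<open>(0, 0)\<close>.\<close>

definition step :: "nat \<Rightarrow> (nat \<Rightarrow> nat) \<Rightarrow> real \<times> real \<Rightarrow> real \<times> nat \<times> bool \<Rightarrow> real \<times> real" where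
  "step k len s x =
     (if fst s \<le> fst x then
        if fst (snd x) \<le> k \<or> snd (snd x) then (real (len (fst (snd x))), real (len (fst (snd x))))
        else (0, snd s + (fst x - fst s))
      else (fst s - fst x, snd s))"

fun state :: "nat \<Rightarrow> (nat \<Rightarrow> nat) \<Rightarrow> sample \<Rightarrow> nat \<Rightarrow> real \<times> real" where
  "state k len \<omega> 0 = (0, 0)"
| "state k len \<omega> (Suc j) = step k len (state k len \<omega> j) (\<omega> j)"

definition clock :: "nat \<Rightarrow> (nat \<Rightarrow> nat) \<Rightarrow> sample \<Rightarrow> nat \<Rightarrow> real" where
  "clock k len \<omega> j = (\<Sum>i<j. fst (\<omega> i)) + fst (state k len \<omega> j)"

text \<open>Written through the state and the current packet alone, so that its conditional mean is
  an integral over one packet.\<close>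

definition clock_incr :: "nat \<Rightarrow> (nat \<Rightarrow> nat) \<Rightarrow> real \<times> real \<Rightarrow> real \<times> nat \<times> bool \<Rightarrow> real" where
  "clock_incr k len s x = fst (step k len s x) + fst x - fst s"

text \<open>Area of the trapezoid under a line of slope 1 that starts at height \<open>snd s\<close>
  and runs for the duration \<open>clock_incr\<close>.\<close>

definition area_incr :: "nat \<Rightarrow> (nat \<Rightarrow> nat) \<Rightarrow> real \<times> real \<Rightarrow> real \<times> nat \<times> bool \<Rightarrow> real" where
  "area_incr k len s x = ((snd s + clock_incr k len s x)\<^sup>2 - (snd s)\<^sup>2) / 2"

lemma arr_eq: "arr \<omega> j = (\<Sum>i<Suc j. fst (\<omega> i))"
  by (simp add: arr_def lessThan_Suc_atMost)

lemma clock_0 [simp]: "clock k len \<omega> 0 = 0"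
  by (simp add: clock_def)

lemma clock_Suc: "clock k len \<omega> (Suc j) = clock k len \<omega> j + clock_incr k len (state k len \<omega> j) (\<omega> j)"
  by (simp add: clock_def clock_incr_def)

section \<open>Integral of the age along a fixed sample path\<close>

context
  fixes k :: nat and len :: "nat \<Rightarrow> nat" and \<omega> :: sample
  assumes gaps_nonneg: "\<And>j. 0 \<le> fst (\<omega> j)"
begin

lemma state_nonneg: "0 \<le> fst (state k len \<omega> j) \<and> 0 \<le> snd (state k len \<omega> j)"
  by (induction j) (auto simp: step_def gaps_nonneg)

lemma clock_incr_nonneg: "0 \<le> clock_incr k len (state k len \<omega> j) (\<omega> j)"
  using gaps_nonneg[of j] state_nonneg[of j] by (auto simp: clock_incr_def step_def)

lemma incseq_clock: "incseq (clock k len \<omega>)"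
  by (intro incseq_SucI) (simp add: clock_Suc clock_incr_nonneg)

text \<open>Ties the state recursion to the model. The value of \<open>busy\<close> may lie before
  the previous arrival, hence the truncation at 0.\<close>

lemma residual_eq: "fst (state k len \<omega> j) = max 0 (busy k len \<omega> j - (\<Sum>i<j. fst (\<omega> i)))"
proof (induction j)
  case (Suc j)
  then show ?case
    using gaps_nonneg[of j] by (auto simp: step_def arr_eq wants_def mark_def coin_def)
qed simp

lemma sent_iff: "sent k len \<omega> j \<longleftrightarrow> fst (state k len \<omega> j) \<le> fst (\<omega> j) \<and> wants k \<omega> j"
  unfolding sent_def residual_eq arr_eq using gaps_nonneg[of j] by auto

text \<open>Generation time of the last update sent among the packets before \<open>j\<close>, or 0
  if there is none, recovered as current time minus age.\<close>

definition last_sent :: "nat \<Rightarrow> real" where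
  "last_sent j = clock k len \<omega> j - snd (state k len \<omega> j)"

lemma last_sent_0 [simp]: "last_sent 0 = 0"
  by (simp add: last_sent_def)

lemma last_sent_Suc: "last_sent (Suc j) = (if sent k len \<omega> j then arr \<omega> j else last_sent j)"
  by (auto simp: last_sent_def sent_iff wants_def mark_def coin_def clock_def step_def arr_eq)

lemma clock_Suc_sent:
  "sent k len \<omega> j \<Longrightarrow> clock k len \<omega> (Suc j) = arr \<omega> j + real (len (mark \<omega> j))"
  by (auto simp: sent_iff wants_def mark_def coin_def clock_def step_def arr_eq)

lemma last_sent_le_clock: "last_sent j \<le> clock k len \<omega> j"
  using state_nonneg[of j] by (simp add: last_sent_def)

lemma clock_le_arr: "sent k len \<omega> j \<Longrightarrow> clock k len \<omega> j \<le> arr \<omega> j"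
  by (auto simp: sent_iff clock_def arr_eq)

lemma incseq_last_sent: "incseq last_sent"
proof (intro incseq_SucI)
  fix j
  show "last_sent j \<le> last_sent (Suc j)"
    using clock_le_arr[of j] last_sent_le_clock[of j] by (auto simp: last_sent_Suc)
qed

text \<open>Puts \<open>last_sent j\<close> into the set whose supremum defines
  \<open>last_gen\<close>: the update has been delivered by the time
  \<open>clock k len \<omega> j\<close>.\<close>

lemma last_sent_cases:
  "last_sent j = 0 \<or> (\<exists>i. last_sent j = arr \<omega> i \<and> sent k len \<omega> i \<and> arr \<omega> i + real (len (mark \<omega> i)) \<le> clock k len \<omega> j)"
proof (induction j)
  case (Suc j)
  have "clock k len \<omega> j \<le> clock k len \<omega> (Suc j)"
    by (rule incseq_SucD[OF incseq_clock])
  then show ?case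
    using Suc clock_Suc_sent[of j] by (cases "sent k len \<omega> j") (force simp: last_sent_Suc)+
qed simp

text \<open>Everything sent before packet \<open>j\<close> is delivered by the left end. A packet
  \<open>i \<ge> j\<close> that is sent is delivered at \<open>clock k len \<omega> (Suc i)\<close>,
  too late for \<open>t\<close>. The interval is open on the right because the age may drop
  there.\<close>

lemma last_gen_eq:
  assumes "clock k len \<omega> j \<le> t" "t < clock k len \<omega> (Suc j)"
  shows "last_gen k len \<omega> t = last_sent j"
  unfolding last_gen_def
proof (rule cSup_eq_maximum)
  show "last_sent j \<in> insert 0 {arr \<omega> j |j. sent k len \<omega> j \<and> arr \<omega> j + real (len (mark \<omega> j)) \<le> t}"
    using last_sent_cases[of j] assms(1) by force
next
  fix y assume "y \<in> insert 0 {arr \<omega> j |j. sent k len \<omega> j \<and> arr \<omega> j + real (len (mark \<omega> j)) \<le> t}"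
  then consider "y = 0" | i where "y = arr \<omega> i" "sent k len \<omega> i" "arr \<omega> i + real (len (mark \<omega> i)) \<le> t"
    by auto
  then show "y \<le> last_sent j"
  proof cases
    case 1
    then show ?thesis using incseqD[OF incseq_last_sent, of 0 j] by simp
  next
    case 2
    have "i < j"
    proof (rule ccontr)
      assume "\<not> i < j"
      then have "clock k len \<omega> (Suc j) \<le> clock k len \<omega> (Suc i)"
        by (intro incseqD[OF incseq_clock]) auto
      then show False using 2 clock_Suc_sent assms(2) by auto
    qed
    then show ?thesis
      using incseqD[OF incseq_last_sent, of "Suc i" j] 2 by (simp add: last_sent_Suc)
  qed
qed

lemma age_has_integral_step:
  "(age k len \<omega> has_integral area_incr k len (state k len \<omega> j) (\<omega> j)) {clock k len \<omega> j..clock k len \<omega> (Suc j)}"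
\<comment> \<open>Only the right end point, a possible jump, has to be removed; elsewhere the age is
  a line of slope 1.\<close>
proof (rule has_integral_spike_finite[where S="{clock k len \<omega> (Suc j)}" and f="\<lambda>t. t - last_sent j"])
  have "((\<lambda>t. t - last_sent j) has_integral
      (clock k len \<omega> (Suc j) - last_sent j)\<^sup>2 / 2 - (clock k len \<omega> j - last_sent j)\<^sup>2 / 2)
      {clock k len \<omega> j..clock k len \<omega> (Suc j)}"
    using incseq_SucD[OF incseq_clock, of j]
    by (intro fundamental_theorem_of_calculus)
      (auto intro!: derivative_eq_intros simp flip: has_real_derivative_iff_has_vector_derivative)
  moreover have "area_incr k len (state k len \<omega> j) (\<omega> j)
      = (clock k len \<omega> (Suc j) - last_sent j)\<^sup>2 / 2 - (clock k len \<omega> j - last_sent j)\<^sup>2 / 2"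
    by (simp add: area_incr_def last_sent_def clock_Suc diff_divide_distrib algebra_simps)
  ultimately show "((\<lambda>t. t - last_sent j) has_integral area_incr k len (state k len \<omega> j) (\<omega> j))
      {clock k len \<omega> j..clock k len \<omega> (Suc j)}"
    by simp
qed (auto simp: age_def last_gen_eq)

lemma age_has_integral_clock:
  "(age k len \<omega> has_integral (\<Sum>j<J. area_incr k len (state k len \<omega> j) (\<omega> j))) {0..clock k len \<omega> J}"
proof (induction J)
  case (Suc J)
  have "0 \<le> clock k len \<omega> J" "clock k len \<omega> J \<le> clock k len \<omega> (Suc J)"
    using incseqD[OF incseq_clock, of 0 J] incseq_SucD[OF incseq_clock, of J] by auto
  then show ?case
    using has_integral_combine[OF _ _ Suc age_has_integral_step[of J]] by simp
qed (simp add: has_integral_refl)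

text \<open>The age is nonnegative, so its integral is monotone in the end point and the average
  along the clock times determines the limit over all times. Linear growth of the clock makes these
  times cover the half line.\<close>

lemma average_age_tendsto:
  assumes clock: "(\<lambda>J. clock k len \<omega> J / real J) \<longlonglongrightarrow> c" "c > 0"
    and area: "(\<lambda>J. (\<Sum>j<J. area_incr k len (state k len \<omega> j) (\<omega> j)) / real J) \<longlonglongrightarrow> d * c"
  shows "((\<lambda>T. integral {0..T} (age k len \<omega>) / T) \<longlongrightarrow> d) at_top"
proof -
  have clock_top: "\<exists>j. t < clock k len \<omega> j" for t
  proof (rule ccontr)
    assume "\<not> (\<exists>j. t < clock k len \<omega> j)"
    then have le: "clock k len \<omega> j \<le> t" for j by (simp add: not_less)
    have "(\<lambda>J. t / real J) \<longlonglongrightarrow> 0" by real_asymp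
    then have "c \<le> 0"
      using clock(1) le by (intro LIMSEQ_le) (auto intro!: exI[of _ 1] divide_right_mono)
    then show False using clock(2) by simp
  qed
  have age_nonneg: "0 \<le> age k len \<omega> t" if t: "0 \<le> t" for t
  proof -
    define j where "j = (LEAST j. t < clock k len \<omega> j)"
    have j: "t < clock k len \<omega> j"
      unfolding j_def by (rule LeastI_ex[OF clock_top])
    then obtain i where i: "j = Suc i" using t by (cases j) auto
    then have "\<not> t < clock k len \<omega> i"
      unfolding j_def by (intro not_less_Least) auto
    then show ?thesis
      using j i last_gen_eq[of i t] last_sent_le_clock[of i] by (simp add: age_def)
  qed
  have int: "age k len \<omega> integrable_on {0..t}" for t
  proof -
    obtain j where "t < clock k len \<omega> j" using clock_top by blast
    then have "{0..t} \<subseteq> {0..clock k len \<omega> j}" by auto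
    then show ?thesis
      by (rule integrable_on_subinterval[OF has_integral_integrable[OF age_has_integral_clock]])
  qed
  show ?thesis
  proof (rule tendsto_ratio_at_top_of_sequence[where x="clock k len \<omega>" and c=c])
    show "(\<lambda>n. integral {0..clock k len \<omega> n} (age k len \<omega>) / real n) \<longlonglongrightarrow> d * c"
      using area by (simp add: integral_unique[OF age_has_integral_clock])
    show "integral {0..s} (age k len \<omega>) \<le> integral {0..t} (age k len \<omega>)" if "0 \<le> s" "s \<le> t" for s t
      using that by (intro integral_subset_le int) (auto simp: age_nonneg)
    show "0 \<le> integral {0..t} (age k len \<omega>)" if "0 \<le> t" for t
      by (intro Henstock_Kurzweil_Integration.integral_nonneg int) (auto simp: age_nonneg)
  qed (use clock incseq_clock in simp_all)
qed

end

section \<open>The random packet sequence\<close>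

text \<open>The state seen by packet \<open>j\<close> depends on earlier packets only. The case
  \<open>i = j\<close> is included, so resampling packet \<open>j\<close> keeps the state it
  meets.\<close>

lemma state_fun_upd: "i \<le> j \<Longrightarrow> state k len (fun_upd \<omega> j x) i = state k len \<omega> i"
  by (induction i) auto

locale selective_encoding =
  fixes lam \<alpha> :: real and p :: "nat pmf" and n k :: nat and len :: "nat \<Rightarrow> nat"
  assumes lam: "0 < lam" and \<alpha>: "0 \<le> \<alpha>" "\<alpha> \<le> 1"
    and supp: "set_pmf p \<subseteq> {1..n}" and k_le: "k \<le> n" and q_pos: "0 < q_ka p n k \<alpha>"
begin

abbreviation "q \<equiv> q_ka p n k \<alpha>"
abbreviation "a \<equiv> EL p n k \<alpha> len"
abbreviation "b \<equiv> EL2 p n k \<alpha> len"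

definition gap :: "real measure" where
  "gap = density lborel (exponential_density lam)"

definition tag :: "(nat \<times> bool) measure" where
  "tag = measure_pmf p \<Otimes>\<^sub>M measure_pmf (bernoulli_pmf \<alpha>)"

definition packet :: "(real \<times> nat \<times> bool) measure" where
  "packet = gap \<Otimes>\<^sub>M tag"

lemma sys_space_eq: "sys_space lam p \<alpha> = PiM UNIV (\<lambda>_. packet)"
  by (simp add: sys_space_def packet_def gap_def tag_def)

lemma sets_gap [measurable_cong]: "sets gap = sets borel"
  by (simp add: gap_def)

lemma sets_tag [measurable_cong]: "sets tag = sets (count_space UNIV \<Otimes>\<^sub>M count_space UNIV)"
  unfolding tag_def by (intro sets_pair_measure_cong) auto

lemma sets_packet [measurable_cong]:
  "sets packet = sets (borel \<Otimes>\<^sub>M (count_space UNIV \<Otimes>\<^sub>M count_space UNIV))"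
  unfolding packet_def by (intro sets_pair_measure_cong sets_gap sets_tag)

sublocale gap: prob_space gap
  unfolding gap_def by (rule prob_space_exponential_density[OF lam])

sublocale tag: prob_space tag
  unfolding tag_def by (intro prob_space_pair measure_pmf.prob_space_axioms)

sublocale packet: prob_space packet
  unfolding packet_def by (intro prob_space_pair gap.prob_space_axioms tag.prob_space_axioms)

sublocale sys: prob_space "PiM UNIV (\<lambda>_::nat. packet)"
  by (intro prob_space_PiM packet.prob_space_axioms)

text \<open>A sum serves as well as a maximum and avoids any treatment of an empty index
  range.\<close>

definition len_bound :: real where
  "len_bound = (\<Sum>i=1..n. real (len i))"

lemma len_le_bound: "i \<in> {1..n} \<Longrightarrow> real (len i) \<le> len_bound"
  unfolding len_bound_def by (rule member_le_sum) auto

lemma len_bound_nonneg: "0 \<le> len_bound"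
  by (simp add: len_bound_def sum_nonneg)

section \<open>Moments of a single packet\<close>

text \<open>Memorylessness: the substitution \<open>t = R + u\<close> splits off the factor
  \<open>exp (- lam * R)\<close>, the probability of a gap beyond \<open>R\<close>, and leaves the
  \<open>m\<close>-th moment of the exponential law.\<close>

lemma gap_tail_moment:
  assumes "0 \<le> R"
  shows "has_bochner_integral gap (\<lambda>t. if R \<le> t then (t - R) ^ m else 0) (exp (- lam * R) * (fact m / lam ^ m))"
proof (rule has_bochner_integral_nn_integral)
  have "(\<integral>\<^sup>+t. ennreal (if R \<le> t then (t - R) ^ m else 0) \<partial>gap)
      = (\<integral>\<^sup>+t. ennreal (exponential_density lam t) * ennreal (if R \<le> t then (t - R) ^ m else 0) \<partial>lborel)"
    unfolding gap_def by (subst nn_integral_density) auto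
  also have "\<dots> = (\<integral>\<^sup>+u. ennreal (exponential_density lam (R + 1 * u)) *
        ennreal (if R \<le> R + 1 * u then (R + 1 * u - R) ^ m else 0) \<partial>lborel)"
    by (subst nn_integral_real_affine[where c=1 and t=R]) auto
  also have "\<dots> = (\<integral>\<^sup>+u. ennreal (exp (- lam * R)) * ennreal (erlang_density 0 lam u * u ^ m) \<partial>lborel)"
  proof (intro nn_integral_cong)
    fix u :: real
    show "ennreal (exponential_density lam (R + 1 * u)) * ennreal (if R \<le> R + 1 * u then (R + 1 * u - R) ^ m else 0)
      = ennreal (exp (- lam * R)) * ennreal (erlang_density 0 lam u * u ^ m)"
    proof (cases "0 \<le> u")
      case True
      have "exponential_density lam (R + 1 * u) * u ^ m = exp (- lam * R) * (exponential_density lam u * u ^ m)"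
        using True assms by (simp add: exponential_density_def algebra_simps flip: exp_add)
      then show ?thesis
        using True assms lam by (simp add: exponential_density_nonneg flip: ennreal_mult')
    qed (simp add: exponential_density_def)
  qed
  also have "\<dots> = ennreal (exp (- lam * R)) * (\<integral>\<^sup>+u. ennreal (erlang_density 0 lam u * u ^ m) \<partial>lborel)"
    by (rule nn_integral_cmult) auto
  also have "\<dots> = ennreal (exp (- lam * R) * (fact m / lam ^ m))"
    unfolding nn_integral_erlang_ith_moment[OF lam] using lam by (simp flip: ennreal_mult')
  finally show "(\<integral>\<^sup>+t. ennreal (if R \<le> t then (t - R) ^ m else 0) \<partial>gap) = ennreal (exp (- lam * R) * (fact m / lam ^ m))" .
qed (use lam in auto)

text \<open>Integrating out the coin first leaves the weight 1 for \<open>i \<le> k\<close> and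
  \<open>\<alpha>\<close> for \<open>i > k\<close>. The weights are not normalised, which is why
  \<open>tag_moments\<close> carries factors \<open>q\<close>.\<close>

lemma tag_weighted_sum:
  "has_bochner_integral tag (\<lambda>y. if fst y \<le> k \<or> snd y then f (fst y) else 0)
     (\<Sum>i=1..n. (if i \<le> k then pmf p i else \<alpha> * pmf p i) * f i)" for f :: "nat \<Rightarrow> real"
proof -
  interpret pair_sigma_finite "measure_pmf p" "measure_pmf (bernoulli_pmf \<alpha>)" ..
  have fin: "finite (set_pmf p)"
    using supp finite_subset by blast
  have int: "integrable tag (\<lambda>y. if fst y \<le> k \<or> snd y then f (fst y) else 0)"
    unfolding tag_def
  proof (rule Fubini_integrable)
    show "(\<lambda>y. if fst y \<le> k \<or> snd y then f (fst y) else 0)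
        \<in> borel_measurable (measure_pmf p \<Otimes>\<^sub>M measure_pmf (bernoulli_pmf \<alpha>))"
      unfolding tag_def[symmetric] by measurable
  qed (auto intro!: integrable_measure_pmf_finite fin)
  have "(\<integral>y. (if fst y \<le> k \<or> snd y then f (fst y) else 0) \<partial>tag)
      = (\<integral>i. (if i \<le> k then 1 else \<alpha>) * f i \<partial>measure_pmf p)"
    using int \<alpha> unfolding tag_def
    by (subst integral_fst'[symmetric]) (auto intro!: Bochner_Integration.integral_cong simp: algebra_simps)
  also have "\<dots> = (\<Sum>i=1..n. (if i \<le> k then pmf p i else \<alpha> * pmf p i) * f i)"
    using supp by (subst integral_measure_pmf[of "{1..n}"]) (auto intro!: sum.cong)
  finally show ?thesis using int by (simp add: has_bochner_integral_iff)
qed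

lemma q_eq: "q = (\<Sum>i=1..n. if i \<le> k then pmf p i else \<alpha> * pmf p i)"
proof -
  have "{1..n} = {1..k} \<union> {k+1..n}" using k_le by auto
  then have "(\<Sum>i=1..n. if i \<le> k then pmf p i else \<alpha> * pmf p i)
     = (\<Sum>i=1..k. if i \<le> k then pmf p i else \<alpha> * pmf p i) + (\<Sum>i=k+1..n. if i \<le> k then pmf p i else \<alpha> * pmf p i)"
    by (simp add: sum.union_disjoint)
  also have "\<dots> = q"
    by (simp add: q_ka_def sum_distrib_left)
  finally show ?thesis by simp
qed

lemma tag_moments:
  "has_bochner_integral tag (\<lambda>y. if fst y \<le> k \<or> snd y then 1 else 0) q"
  "has_bochner_integral tag (\<lambda>y. if fst y \<le> k \<or> snd y then real (len (fst y)) else 0) (q * a)"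
  "has_bochner_integral tag (\<lambda>y. if fst y \<le> k \<or> snd y then (real (len (fst y)))\<^sup>2 else 0) (q * b)"
proof -
  show "has_bochner_integral tag (\<lambda>y. if fst y \<le> k \<or> snd y then 1 else 0) q"
    using tag_weighted_sum[of "\<lambda>_. 1"] by (simp add: q_eq)
  have "q * a = (\<Sum>i=1..n. (if i \<le> k then pmf p i else \<alpha> * pmf p i) * real (len i))"
    using q_pos unfolding EL_def sum_distrib_left by (intro sum.cong) (auto simp: P_Xa_def)
  then show "has_bochner_integral tag (\<lambda>y. if fst y \<le> k \<or> snd y then real (len (fst y)) else 0) (q * a)"
    using tag_weighted_sum[of "\<lambda>i. real (len i)"] by simp
  have "q * b = (\<Sum>i=1..n. (if i \<le> k then pmf p i else \<alpha> * pmf p i) * (real (len i))\<^sup>2)"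
    using q_pos unfolding EL2_def sum_distrib_left by (intro sum.cong) (auto simp: P_Xa_def)
  then show "has_bochner_integral tag (\<lambda>y. if fst y \<le> k \<or> snd y then (real (len (fst y)))\<^sup>2 else 0) (q * b)"
    using tag_weighted_sum[of "\<lambda>i. (real (len i))\<^sup>2"] by simp
qed

lemma b_nonneg: "0 \<le> b" and a_nonneg: "0 \<le> a"
  using q_pos \<alpha> by (auto simp: EL2_def EL_def P_Xa_def intro!: sum_nonneg)

text \<open>Power of the idle time before the arrival, cut to 0 if the packet finds the transmitter
  busy, times a function of the tag. All functionals of one step used below are linear combinations
  of these, and their means factor by independence of gap and tag.\<close>

definition idle_moment :: "real \<Rightarrow> nat \<Rightarrow> (nat \<times> bool \<Rightarrow> real) \<Rightarrow> real \<times> nat \<times> bool \<Rightarrow> real" where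
  "idle_moment R m h x = (if R \<le> fst x then (fst x - R) ^ m else 0) * h (snd x)"

definition one :: "nat \<times> bool \<Rightarrow> real" where "one y = 1"

text \<open>For \<open>m = 0\<close> this is the acceptance indicator, also for codewords of length
  0.\<close>

definition wanted :: "nat \<Rightarrow> nat \<times> bool \<Rightarrow> real" where
  "wanted m y = (if fst y \<le> k \<or> snd y then real (len (fst y)) ^ m else 0)"

lemma idle_moment_integral:
  assumes "0 \<le> R"
  shows "has_bochner_integral packet (idle_moment R m one) (exp (- lam * R) * (fact m / lam ^ m))"
    and "has_bochner_integral packet (idle_moment R m (wanted 0)) (exp (- lam * R) * (fact m / lam ^ m) * q)"
    and "has_bochner_integral packet (idle_moment R m (wanted 1)) (exp (- lam * R) * (fact m / lam ^ m) * (q * a))"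
    and "has_bochner_integral packet (idle_moment R m (wanted 2)) (exp (- lam * R) * (fact m / lam ^ m) * (q * b))"
proof -
  have *: "has_bochner_integral packet (idle_moment R m h) (exp (- lam * R) * (fact m / lam ^ m) * H)"
    if "has_bochner_integral tag h H" for h H
    unfolding packet_def idle_moment_def
    by (intro has_bochner_integral_pair_mult gap_tail_moment assms that gap.sigma_finite_measure_axioms
        tag.sigma_finite_measure_axioms)
  have "has_bochner_integral tag one 1"
    unfolding one_def by (simp add: has_bochner_integral_iff tag.prob_space)
  from *[OF this] show "has_bochner_integral packet (idle_moment R m one) (exp (- lam * R) * (fact m / lam ^ m))"
    by simp
  show "has_bochner_integral packet (idle_moment R m (wanted 0)) (exp (- lam * R) * (fact m / lam ^ m) * q)"
    using tag_moments(1) unfolding wanted_def[abs_def] power_0 power_one_right by (rule *)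
  show "has_bochner_integral packet (idle_moment R m (wanted 1)) (exp (- lam * R) * (fact m / lam ^ m) * (q * a))"
    using tag_moments(2) unfolding wanted_def[abs_def] power_0 power_one_right by (rule *)
  show "has_bochner_integral packet (idle_moment R m (wanted 2)) (exp (- lam * R) * (fact m / lam ^ m) * (q * b))"
    using tag_moments(3) unfolding wanted_def[abs_def] power_0 power_one_right by (rule *)
qed

section \<open>Almost sure bounds and measurability of the state\<close>

lemma AE_packet: "AE x in packet. 0 \<le> fst x \<and> fst (snd x) \<in> {1..n}"
proof -
  interpret T: pair_sigma_finite "measure_pmf p" "measure_pmf (bernoulli_pmf \<alpha>)" ..
  interpret pair_sigma_finite gap tag ..
  have t: "AE y in tag. fst y \<in> {1..n}"
    unfolding tag_def
  proof (rule T.AE_pair_measure)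
    show "{x \<in> space (measure_pmf p \<Otimes>\<^sub>M measure_pmf (bernoulli_pmf \<alpha>)). fst x \<in> {1..n}}
        \<in> sets (measure_pmf p \<Otimes>\<^sub>M measure_pmf (bernoulli_pmf \<alpha>))"
      unfolding tag_def[symmetric] atLeastAtMost_iff by measurable
  qed (use supp in \<open>auto simp: AE_measure_pmf_iff\<close>)
  have g: "AE t in gap. 0 \<le> t"
    unfolding gap_def by (subst AE_density) (auto simp: exponential_density_def intro!: AE_I2)
  show ?thesis
    unfolding packet_def
  proof (rule AE_pair_measure)
    show "{x \<in> space (gap \<Otimes>\<^sub>M tag). 0 \<le> fst x \<and> fst (snd x) \<in> {1..n}} \<in> sets (gap \<Otimes>\<^sub>M tag)"
      unfolding atLeastAtMost_iff by measurable
    show "AE x in gap. AE y in tag. 0 \<le> fst (x, y) \<and> fst (snd (x, y)) \<in> {1..n}"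
      using g by eventually_elim (use t in auto)
  qed
qed

lemma AE_sample: "AE \<omega> in PiM UNIV (\<lambda>_. packet). \<forall>j::nat. 0 \<le> fst (\<omega> j) \<and> fst (snd (\<omega> j)) \<in> {1..n}"
  unfolding AE_all_countable
  by (intro allI AE_PiM_component AE_packet packet.prob_space_axioms) auto

text \<open>The residual jumps to a codeword length at a transmission and otherwise only
  decreases.\<close>

lemma residual_le_bound:
  assumes "\<And>j. 0 \<le> fst (\<omega> j) \<and> fst (snd (\<omega> j)) \<in> {1..n}"
  shows "fst (state k len \<omega> j) \<le> len_bound"
proof (induction j)
  case (Suc j)
  then show ?case
    using assms[of j] len_bound_nonneg len_le_bound by (auto simp: step_def)
qed (simp add: len_bound_nonneg)

lemma AE_state:
  "AE \<omega> in PiM UNIV (\<lambda>_. packet).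
     0 \<le> fst (state k len \<omega> j) \<and> fst (state k len \<omega> j) \<le> len_bound \<and> 0 \<le> snd (state k len \<omega> j)"
  using AE_sample
proof eventually_elim
  case (elim \<omega>)
  then show ?case using state_nonneg[of \<omega> k len j] residual_le_bound[of \<omega> j] by auto
qed

lemma measurable_step [measurable]:
  "(\<lambda>(s, x). step k len s x) \<in> (borel \<Otimes>\<^sub>M borel) \<Otimes>\<^sub>M packet \<rightarrow>\<^sub>M borel \<Otimes>\<^sub>M borel"
  unfolding step_def[abs_def] by measurable

lemma measurable_step' [measurable (raw)]:
  "f \<in> M \<rightarrow>\<^sub>M borel \<Otimes>\<^sub>M borel \<Longrightarrow> g \<in> M \<rightarrow>\<^sub>M packet \<Longrightarrow> (\<lambda>x. step k len (f x) (g x)) \<in> M \<rightarrow>\<^sub>M borel \<Otimes>\<^sub>M borel"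
  using measurable_compose[OF measurable_Pair measurable_step, of f M g] by simp

lemma measurable_state [measurable]:
  "(\<lambda>\<omega>. state k len \<omega> j) \<in> PiM UNIV (\<lambda>_. packet) \<rightarrow>\<^sub>M borel \<Otimes>\<^sub>M borel"
proof (induction j)
  case (Suc j)
  note Suc [measurable]
  show ?case by (simp only: state.simps) measurable
qed simp

section \<open>Second moment of the age at the clock times\<close>

text \<open>An idle transmitter accepts with probability \<open>q\<close>, and the next arrival finds it idle with
  probability at least \<open>exp (- lam * len_bound)\<close>; hence the geometric decay rate of the second moment.\<close>

definition drift_rate :: real where "drift_rate = min 1 (exp (- lam * len_bound) * q / 2)"
definition drift_const :: real where "drift_const = 2 / lam\<^sup>2 + 2 / (q * lam\<^sup>2) + q * b"

lemma drift_rate: "0 < drift_rate" "drift_rate \<le> 1"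
  using q_pos by (auto simp: drift_rate_def)

lemma drift_const_nonneg: "0 \<le> drift_const"
  using q_pos lam b_nonneg by (auto simp: drift_const_def)

text \<open>A geometric drift inequality for the squared age: acceptance resets it to a squared
  length, while a rejected arrival at an idle transmitter adds only an exponential waiting
  time.\<close>

lemma step_second_moment:
  assumes R: "0 \<le> fst s" "fst s \<le> len_bound" and v: "0 \<le> snd s"
  shows "(\<integral>\<^sup>+x. ennreal ((snd (step k len s x))\<^sup>2) \<partial>packet) \<le> ennreal ((1 - drift_rate) * (snd s)\<^sup>2 + drift_const)"
proof -
  obtain r v where s: "s = (r, v)" by (cases s)
  define \<rho> where "\<rho> = exp (- lam * r)"
  note moments = idle_moment_integral[OF R(1), unfolded s fst_conv]
  have eq: "(snd (step k len s x))\<^sup>2 = v\<^sup>2 + idle_moment r 2 one x + 2 * v * idle_moment r 1 one x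
      - idle_moment r 2 (wanted 0) x - 2 * v * idle_moment r 1 (wanted 0) x
      - v\<^sup>2 * idle_moment r 0 (wanted 0) x + idle_moment r 0 (wanted 2) x" for x
    by (auto simp: s step_def idle_moment_def one_def wanted_def power2_eq_square algebra_simps)
  have int: "has_bochner_integral packet (\<lambda>x. (snd (step k len s x))\<^sup>2)
     (v\<^sup>2 + \<rho> * (fact 2 / lam ^ 2) + 2 * v * (\<rho> * (fact 1 / lam ^ 1))
      - \<rho> * (fact 2 / lam ^ 2) * q - 2 * v * (\<rho> * (fact 1 / lam ^ 1) * q)
      - v\<^sup>2 * (\<rho> * (fact 0 / lam ^ 0) * q) + \<rho> * (fact 0 / lam ^ 0) * (q * b))" (is "has_bochner_integral _ _ ?I")
    unfolding eq \<rho>_def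
    by (intro has_bochner_integral_add has_bochner_integral_diff has_bochner_integral_mult_right moments)
      (simp add: has_bochner_integral_iff packet.prob_space)
  have "(\<integral>\<^sup>+x. ennreal ((snd (step k len s x))\<^sup>2) \<partial>packet) = ennreal ?I"
    using int by (subst nn_integral_eq_integral) (auto simp: has_bochner_integral_iff)
  also have "?I \<le> (1 - drift_rate) * v\<^sup>2 + drift_const"
  proof -
    have \<rho>: "0 < \<rho>" "\<rho> \<le> 1" "exp (- lam * len_bound) \<le> \<rho>"
      using R lam by (auto simp: \<rho>_def s)
    \<comment> \<open>Completing the square absorbs the linear term into half of the decay
      \<open>q * v\<^sup>2\<close>. This produces the factor 1/2 in \<open>drift_rate\<close> and
      the term \<open>2 / (q * lam\<^sup>2)\<close> in \<open>drift_const\<close>.\<close>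
    have "0 \<le> (q * v - 2 / lam)\<^sup>2 / (2 * q)"
      using q_pos by simp
    also have "\<dots> = q / 2 * v\<^sup>2 - 2 * v / lam + 2 / (q * lam\<^sup>2)"
      using q_pos lam by (simp add: field_simps power2_eq_square)
    finally have young: "2 * v / lam \<le> q / 2 * v\<^sup>2 + 2 / (q * lam\<^sup>2)" by simp
    have "?I = v\<^sup>2 + \<rho> * (2 / lam\<^sup>2 + 2 * v / lam - q * (2 / lam\<^sup>2 + 2 * v / lam) - q * v\<^sup>2 + q * b)"
      by (simp add: algebra_simps numeral_2_eq_2)
    also have "\<dots> \<le> v\<^sup>2 + \<rho> * (drift_const - q / 2 * v\<^sup>2)"
    proof -
      have "0 \<le> q * (2 / lam\<^sup>2 + 2 * v / lam)"
        using q_pos lam assms(3) by (auto simp: s)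
      then show ?thesis
        using \<rho> young by (intro add_left_mono mult_left_mono) (auto simp: drift_const_def)
    qed
    also have "\<dots> \<le> v\<^sup>2 + drift_const - drift_rate * v\<^sup>2"
    proof -
      have "\<rho> * drift_const \<le> 1 * drift_const"
        using \<rho> drift_const_nonneg by (intro mult_right_mono) auto
      moreover have "drift_rate * v\<^sup>2 \<le> (\<rho> * (q / 2)) * v\<^sup>2"
      proof (rule mult_right_mono)
        have "drift_rate \<le> exp (- lam * len_bound) * (q / 2)" by (simp add: drift_rate_def)
        also have "\<dots> \<le> \<rho> * (q / 2)" using \<rho> q_pos by (intro mult_right_mono) auto
        finally show "drift_rate \<le> \<rho> * (q / 2)" .
      qed simp
      ultimately show ?thesis by (simp add: algebra_simps)
    qed
    finally show ?thesis by (simp add: algebra_simps)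
  qed
  finally show ?thesis by (simp add: s ennreal_leI)
qed

text \<open>The bound is the fixed point of the affine recursion given by
  \<open>step_second_moment\<close>, and the initial value 0 lies below it.\<close>

lemma state_second_moment:
  "(\<integral>\<^sup>+\<omega>. ennreal ((snd (state k len \<omega> j))\<^sup>2) \<partial>PiM UNIV (\<lambda>_. packet)) \<le> ennreal (drift_const / drift_rate)"
proof (induction j)
  case (Suc j)
  have "(\<integral>\<^sup>+\<omega>. ennreal ((snd (state k len \<omega> (Suc j)))\<^sup>2) \<partial>PiM UNIV (\<lambda>_. packet))
      = (\<integral>\<^sup>+\<omega>. \<integral>\<^sup>+x. ennreal ((snd (step k len (state k len \<omega> j) x))\<^sup>2) \<partial>packet \<partial>PiM UNIV (\<lambda>_. packet))"
    by (subst nn_integral_resample[OF packet.prob_space_axioms, where j=j]) (simp_all add: state_fun_upd del: state.simps(2), simp add: state_fun_upd)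
  also have "\<dots> \<le> (\<integral>\<^sup>+\<omega>. ennreal (1 - drift_rate) * ennreal ((snd (state k len \<omega> j))\<^sup>2) + ennreal drift_const \<partial>PiM UNIV (\<lambda>_. packet))"
  proof (rule nn_integral_mono_AE)
    show "AE \<omega> in PiM UNIV (\<lambda>_. packet). (\<integral>\<^sup>+x. ennreal ((snd (step k len (state k len \<omega> j) x))\<^sup>2) \<partial>packet)
        \<le> ennreal (1 - drift_rate) * ennreal ((snd (state k len \<omega> j))\<^sup>2) + ennreal drift_const"
      using AE_state[of j]
    proof eventually_elim
      case (elim \<omega>)
      then show ?case
        using step_second_moment[of "state k len \<omega> j"] drift_rate drift_const_nonneg by (simp add: ennreal_plus ennreal_mult)
    qed
  qed
  also have "\<dots> = ennreal (1 - drift_rate) * (\<integral>\<^sup>+\<omega>. ennreal ((snd (state k len \<omega> j))\<^sup>2) \<partial>PiM UNIV (\<lambda>_. packet)) + ennreal drift_const"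
    by (simp add: nn_integral_add nn_integral_cmult sys.emeasure_space_1)
  also have "\<dots> \<le> ennreal (1 - drift_rate) * ennreal (drift_const / drift_rate) + ennreal drift_const"
    by (intro add_right_mono mult_left_mono Suc) auto
  also have "\<dots> = ennreal ((1 - drift_rate) * (drift_const / drift_rate) + drift_const)"
    using drift_rate drift_const_nonneg by (simp add: ennreal_plus ennreal_mult del: times_divide_eq_right)
  also have "(1 - drift_rate) * (drift_const / drift_rate) + drift_const = drift_const / drift_rate"
    using drift_rate by (simp add: field_simps)
  finally show ?case .
qed simp

text \<open>With bounded second moments, the square of \<open>v / j\<close> has mean of order
  \<open>1 / j\<^sup>2\<close>, which is summable.\<close>

lemma AE_state_sublinear: "AE \<omega> in PiM UNIV (\<lambda>_. packet). (\<lambda>j. snd (state k len \<omega> j) / real j) \<longlonglongrightarrow> 0"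
proof -
  have "AE \<omega> in PiM UNIV (\<lambda>_. packet). (\<lambda>j. (snd (state k len \<omega> j) / real j)\<^sup>2) \<longlonglongrightarrow> 0"
  proof (rule AE_tendsto_zero_if_summable_integrals[where c="\<lambda>j. (drift_const / drift_rate) * inverse (real j ^ 2)"])
    fix j :: nat
    have "(\<integral>\<^sup>+\<omega>. ennreal ((snd (state k len \<omega> j) / real j)\<^sup>2) \<partial>PiM UNIV (\<lambda>_. packet))
        = (\<integral>\<^sup>+\<omega>. ennreal ((snd (state k len \<omega> j))\<^sup>2) * ennreal (inverse (real j ^ 2)) \<partial>PiM UNIV (\<lambda>_. packet))"
      by (simp add: divide_inverse power_mult_distrib power_inverse flip: ennreal_mult)
    also have "\<dots> = (\<integral>\<^sup>+\<omega>. ennreal ((snd (state k len \<omega> j))\<^sup>2) \<partial>PiM UNIV (\<lambda>_. packet)) * ennreal (inverse (real j ^ 2))"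
      by (rule nn_integral_multc) measurable
    also have "\<dots> \<le> ennreal (drift_const / drift_rate) * ennreal (inverse (real j ^ 2))"
      by (intro mult_right_mono state_second_moment) auto
    also have "\<dots> = ennreal ((drift_const / drift_rate) * inverse (real j ^ 2))"
      using drift_rate drift_const_nonneg by (simp flip: ennreal_mult)
    finally show "(\<integral>\<^sup>+\<omega>. ennreal ((snd (state k len \<omega> j) / real j)\<^sup>2) \<partial>PiM UNIV (\<lambda>_. packet))
        \<le> ennreal ((drift_const / drift_rate) * inverse (real j ^ 2))" .
  qed (use drift_rate drift_const_nonneg in \<open>auto intro!: summable_mult inverse_power_summable\<close>)
  then show ?thesis
  proof eventually_elim
    case (elim \<omega>)
    then have "(\<lambda>j. sqrt ((snd (state k len \<omega> j) / real j)\<^sup>2)) \<longlonglongrightarrow> sqrt 0"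
      by (intro tendsto_intros)
    then show ?case by (simp only: real_sqrt_abs real_sqrt_zero tendsto_rabs_zero_iff)
  qed
qed


section \<open>The Poisson equation for the average age\<close>

text \<open>\<open>\<Delta>\<close> is the average age and \<open>v \<mapsto> \<gamma> * v\<close> solves the Poisson equation of the chain \<open>state\<close>: these
  two constants are exactly the ones that make \<open>gain\<close> below centered for every value of the state.\<close>

definition \<gamma> :: real where "\<gamma> = a + 1 / (q * lam)"
definition \<Delta> :: real where "\<Delta> = \<gamma> + b / (2 * \<gamma>)"

definition gain :: "real \<times> real \<Rightarrow> real \<times> nat \<times> bool \<Rightarrow> real" where
  "gain s x = area_incr k len s x - \<Delta> * clock_incr k len s x + \<gamma> * (snd (step k len s x) - snd s)"

lemma \<gamma>_pos: "0 < \<gamma>"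
  using a_nonneg q_pos lam by (auto simp: \<gamma>_def intro!: add_nonneg_pos)

text \<open>With \<open>z = 1 / (q * lam)\<close> the last two terms of the numerator add up to
  \<open>2 * z * \<gamma>\<close>, so the quotient equals
  \<open>b / (2 * \<gamma>) + z\<close>.\<close>

lemma \<Delta>_eq:
  "\<Delta> = (b + 2 / (q * lam) * a + 2 / (q * lam)^2) / (2 * (a + 1 / (q * lam))) + a"
proof -
  define z where "z = 1 / (q * lam)"
  have "0 < a + z" using \<gamma>_pos by (simp add: \<gamma>_def z_def)
  moreover have "2 / (q * lam) = 2 * z" "2 / (q * lam)^2 = 2 * z^2"
    by (auto simp: z_def power_divide)
  ultimately show ?thesis
    unfolding \<Delta>_def \<gamma>_def z_def[symmetric] by (simp add: field_simps power2_eq_square)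
qed

lemma measurable_gain [measurable (raw)]:
  assumes [measurable]: "f \<in> M \<rightarrow>\<^sub>M borel \<Otimes>\<^sub>M borel" "g \<in> M \<rightarrow>\<^sub>M packet"
  shows "(\<lambda>x. gain (f x) (g x)) \<in> borel_measurable M"
proof -
  have [measurable]: "(\<lambda>x. fst (g x)) \<in> borel_measurable M"
    by (rule measurable_compose[OF assms(2)]) measurable
  show ?thesis
    unfolding gain_def area_incr_def clock_incr_def by measurable
qed

text \<open>The three cases are an accepted packet, a rejected packet at an idle transmitter, and an
  arrival during a transmission. In the last one neither the clock nor the age moves, so the gain is
  0.\<close>

lemma gain_expand:
  "gain (r, v) x = 1 / 2 * idle_moment r 2 one x + (v - \<Delta> + \<gamma>) * idle_moment r 1 one x
     - \<gamma> * v * idle_moment r 0 (wanted 0) x - \<gamma> * idle_moment r 1 (wanted 0) x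
     + idle_moment r 1 (wanted 1) x + (v - \<Delta> + \<gamma>) * idle_moment r 0 (wanted 1) x
     + 1 / 2 * idle_moment r 0 (wanted 2) x"
proof -
  obtain t i c where x: "x = (t, i, c)" by (cases x)
  consider "r \<le> t" "i \<le> k \<or> c" | "r \<le> t" "\<not> (i \<le> k \<or> c)" | "\<not> r \<le> t" by blast
  then show ?thesis
  proof cases
    case 1
    then have "gain (r, v) x = ((v + (real (len i) + t - r))\<^sup>2 - v\<^sup>2) / 2 - \<Delta> * (real (len i) + t - r) + \<gamma> * (real (len i) - v)"
      by (simp add: gain_def area_incr_def clock_incr_def step_def x)
    also have "\<dots> = 1 / 2 * (t - r)\<^sup>2 + (v - \<Delta> + \<gamma>) * (t - r) - \<gamma> * v - \<gamma> * (t - r)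
       + (t - r) * real (len i) + (v - \<Delta> + \<gamma>) * real (len i) + 1 / 2 * (real (len i))\<^sup>2"
      by (simp add: field_simps power2_eq_square)
    finally show ?thesis
      using 1 by (simp add: idle_moment_def one_def wanted_def x)
  next
    case 2
    then have "gain (r, v) x = ((v + (t - r))\<^sup>2 - v\<^sup>2) / 2 - \<Delta> * (t - r) + \<gamma> * (t - r)"
      by (simp add: gain_def area_incr_def clock_incr_def step_def x)
    also have "\<dots> = 1 / 2 * (t - r)\<^sup>2 + (v - \<Delta> + \<gamma>) * (t - r)"
      by (simp add: field_simps power2_eq_square)
    finally show ?thesis
      using 2 by (simp add: idle_moment_def one_def wanted_def x)
  next
    case 3
    then show ?thesis
      by (simp add: gain_def area_incr_def clock_incr_def step_def idle_moment_def x)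
  qed
qed

lemma gain_centered:
  assumes "0 \<le> fst s"
  shows "(\<integral>x. gain s x \<partial>packet) = 0"
proof -
  obtain r v where s: "s = (r, v)" by (cases s)
  define \<rho> where "\<rho> = exp (- lam * r)"
  note moments = idle_moment_integral[OF assms, unfolded s fst_conv]
  have "has_bochner_integral packet (gain s)
     (1 / 2 * (\<rho> * (fact 2 / lam ^ 2)) + (v - \<Delta> + \<gamma>) * (\<rho> * (fact 1 / lam ^ 1))
     - \<gamma> * v * (\<rho> * (fact 0 / lam ^ 0) * q) - \<gamma> * (\<rho> * (fact 1 / lam ^ 1) * q)
     + \<rho> * (fact 1 / lam ^ 1) * (q * a) + (v - \<Delta> + \<gamma>) * (\<rho> * (fact 0 / lam ^ 0) * (q * a))
     + 1 / 2 * (\<rho> * (fact 0 / lam ^ 0) * (q * b)))" (is "has_bochner_integral _ _ ?I")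
    unfolding s gain_expand[abs_def] \<rho>_def
    by (intro has_bochner_integral_add has_bochner_integral_diff has_bochner_integral_mult_right moments)
  moreover have "?I = 0"
  proof -
    \<comment> \<open>This cancels the coefficient of \<open>v\<close>. What remains is
      \<open>(\<gamma> - \<Delta>) * \<gamma> * q + q * b / 2\<close>, which \<open>qb\<close>
      cancels.\<close>
    have qa: "q * a = \<gamma> * q - 1 / lam"
      using q_pos lam by (simp add: \<gamma>_def field_simps)
    have qb: "q * b = 2 * \<gamma> * (\<Delta> - \<gamma>) * q"
      using \<gamma>_pos by (simp add: \<Delta>_def field_simps)
    have "?I = \<rho> * (1 / lam ^ 2 + (v - \<Delta> + \<gamma>) / lam - \<gamma> * v * q - \<gamma> * q / lam
        + (q * a) / lam + (v - \<Delta> + \<gamma>) * (q * a) + (q * b) / 2)"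
      by (simp add: algebra_simps add_divide_distrib diff_divide_distrib)
    also have "\<dots> = 0"
      unfolding qa qb by (simp add: algebra_simps add_divide_distrib diff_divide_distrib power2_eq_square)
    finally show ?thesis .
  qed
  ultimately show ?thesis by (simp add: has_bochner_integral_iff)
qed

section \<open>Second moment of the gain\<close>

text \<open>Collects the constants of the term by term estimate in
  \<open>gain_bound\<close>.\<close>

definition gain_coeff :: real where
  "gain_coeff = 3 / 2 + 2 * len_bound + len_bound\<^sup>2 / 2 + \<bar>\<Delta>\<bar> * (1 + len_bound) + \<gamma> * (2 + len_bound)"

text \<open>Linear growth in the age and quadratic growth in the gap, uniformly in the residual: the
  latter enters only through the idle time, which is at most the gap. Squaring then requires only
  the second moment of the age and the fourth moment of the gap.\<close>

lemma gain_bound: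
  assumes r: "0 \<le> r" and v: "0 \<le> v" and x: "0 \<le> fst x" "fst (snd x) \<in> {1..n}"
  shows "\<bar>gain (r, v) x\<bar> \<le> gain_coeff * ((1 + v) * (1 + fst x)\<^sup>2)"
proof -
  obtain t i c where x': "x = (t, i, c)" by (cases x)
  define m where "m = (1 + v) * (1 + t)\<^sup>2"
  have t: "0 \<le> t" and l: "0 \<le> real (len i)" "real (len i) \<le> len_bound"
    using x len_le_bound by (auto simp: x')
  have gain_coeff_nonneg: "0 \<le> gain_coeff"
    using len_bound_nonneg \<gamma>_pos by (auto simp: gain_coeff_def intro!: add_nonneg_nonneg)
  have m_nonneg: "0 \<le> m" using v by (simp add: m_def)
  show ?thesis
  proof (cases "r \<le> t")
    case False
    then have "gain (r, v) x = 0"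
      by (simp add: gain_def area_incr_def clock_incr_def step_def x')
    then show ?thesis
      using gain_coeff_nonneg m_nonneg by (simp add: m_def x')
  next
    case True
    define u where "u = t - r"
    define l where "l = (if i \<le> k \<or> c then real (len i) else 0)"
    define w where "w = snd (step k len (r, v) x) - v"
    have u: "0 \<le> u" "u \<le> t" using True r by (auto simp: u_def)
    have l: "0 \<le> l" "l \<le> len_bound" using l len_bound_nonneg by (auto simp: l_def)
    have m_ge: "1 \<le> m" "v \<le> m" "u \<le> m" "v * u \<le> m" "u\<^sup>2 \<le> m"
    proof -
      have "m = 1 + v + (2 * t + t\<^sup>2) + v * (2 * t + t\<^sup>2)"
        by (simp add: m_def power2_eq_square algebra_simps)
      moreover have "0 \<le> t\<^sup>2" "0 \<le> v * (2 * t + t\<^sup>2)" "u\<^sup>2 \<le> t\<^sup>2" "v * u \<le> v * (2 * t + t\<^sup>2)"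
        using t v u by (auto intro!: mult_left_mono power_mono intro: order_trans)
      ultimately show "1 \<le> m" "v \<le> m" "u \<le> m" "v * u \<le> m" "u\<^sup>2 \<le> m"
        using t v u by linarith+
    qed
    have eq: "gain (r, v) x = v * u + u\<^sup>2 / 2 + v * l + u * l + l\<^sup>2 / 2 - \<Delta> * (u + l) + \<gamma> * w"
      using True by (auto simp: gain_def area_incr_def clock_incr_def step_def x' u_def l_def w_def field_simps power2_eq_square)
    \<comment> \<open>The change of \<open>v\<close> is \<open>l - v\<close> after acceptance and
      \<open>u\<close> after rejection.\<close>
    have w: "\<bar>w\<bar> \<le> u + v + l"
      using True u v l by (auto simp: w_def step_def x' u_def l_def)
    have "\<bar>gain (r, v) x\<bar> \<le> v * u + u\<^sup>2 / 2 + v * l + u * l + l\<^sup>2 / 2 + \<bar>\<Delta>\<bar> * (u + l) + \<gamma> * \<bar>w\<bar>"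
    proof -
      have "\<bar>\<Delta> * (u + l)\<bar> = \<bar>\<Delta>\<bar> * (u + l)" "\<bar>\<gamma> * w\<bar> = \<gamma> * \<bar>w\<bar>"
        using u l \<gamma>_pos by (auto simp: abs_mult)
      moreover have "0 \<le> v * u" "0 \<le> u\<^sup>2" "0 \<le> v * l" "0 \<le> u * l" "0 \<le> l\<^sup>2"
        using u l v by auto
      ultimately show ?thesis unfolding eq by linarith
    qed
    also have "\<dots> \<le> m + m / 2 + m * len_bound + m * len_bound + (m * len_bound\<^sup>2) / 2 + \<bar>\<Delta>\<bar> * (m + m * len_bound) + \<gamma> * (m + m + m * len_bound)"
    proof -
      have mB: "l \<le> m * len_bound"
        using l m_ge len_bound_nonneg mult_right_mono[of 1 m len_bound] by auto
      have "l\<^sup>2 \<le> 1 * len_bound\<^sup>2" using l by (simp add: power_mono)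
      also have "\<dots> \<le> m * len_bound\<^sup>2" using m_ge by (intro mult_right_mono) auto
      finally have l2: "l\<^sup>2 \<le> m * len_bound\<^sup>2" .
      have "v * l \<le> m * len_bound" "u * l \<le> m * len_bound"
        using m_ge l u v by (auto intro!: mult_mono)
      moreover have "\<bar>\<Delta>\<bar> * (u + l) \<le> \<bar>\<Delta>\<bar> * (m + m * len_bound)"
        using m_ge mB by (intro mult_left_mono) auto
      moreover have "\<gamma> * \<bar>w\<bar> \<le> \<gamma> * (m + m + m * len_bound)"
        using m_ge mB w \<gamma>_pos by (intro mult_left_mono) auto
      ultimately show ?thesis using m_ge l2 by linarith
    qed
    also have "\<dots> = gain_coeff * m"
      by (simp add: gain_coeff_def algebra_simps)
    finally show ?thesis by (simp add: m_def x')
  qed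
qed

text \<open>Applying \<open>(1 + y)\<^sup>2 \<le> 2 + 2 * y\<^sup>2\<close> twice bounds the
  integrand by \<open>8 + 8 * t ^ 4\<close>. With residual 0 the idle moment is the plain moment of
  the gap.\<close>

lemma gap_fourth_moment: "(\<integral>\<^sup>+x. ennreal (((1 + fst x)\<^sup>2)\<^sup>2) \<partial>packet) \<le> ennreal (8 + 8 * (fact 4 / lam ^ 4))"
proof -
  have int: "has_bochner_integral packet (\<lambda>x. 8 + 8 * idle_moment 0 4 one x) (8 + 8 * (fact 4 / lam ^ 4))"
    using idle_moment_integral(1)[of 0 4]
    by (intro has_bochner_integral_add has_bochner_integral_mult_right) (auto simp: has_bochner_integral_iff packet.prob_space)
  have "(\<integral>\<^sup>+x. ennreal (((1 + fst x)\<^sup>2)\<^sup>2) \<partial>packet) \<le> (\<integral>\<^sup>+x. ennreal (8 + 8 * idle_moment 0 4 one x) \<partial>packet)"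
  proof (rule nn_integral_mono_AE)
    show "AE x in packet. ennreal (((1 + fst x)\<^sup>2)\<^sup>2) \<le> ennreal (8 + 8 * idle_moment 0 4 one x)"
      using AE_packet
    proof eventually_elim
      case (elim x)
      define t where "t = fst x"
      have sq: "(1 + y)\<^sup>2 \<le> 2 + 2 * y\<^sup>2" for y :: real
        using sum_squares_bound[of 1 y] by (simp add: power2_sum)
      have "((1 + t)\<^sup>2)\<^sup>2 \<le> (2 * (1 + t\<^sup>2))\<^sup>2"
        using sq[of t] by (intro power_mono) auto
      also have "\<dots> \<le> 4 * (2 + 2 * (t\<^sup>2)\<^sup>2)"
        using sq[of "t\<^sup>2"] by (simp only: power_mult_distrib) simp
      also have "\<dots> = 8 + 8 * t ^ 4" by (simp flip: power_mult)
      finally show ?case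
        using elim by (intro ennreal_leI) (simp add: idle_moment_def one_def t_def)
    qed
  qed
  also have "\<dots> = ennreal (8 + 8 * (fact 4 / lam ^ 4))"
    using int by (subst nn_integral_eq_integral) (auto simp: has_bochner_integral_iff idle_moment_def one_def)
  finally show ?thesis .
qed

definition gain_moment_const :: real where "gain_moment_const = 2 * gain_coeff\<^sup>2 * (8 + 8 * (fact 4 / lam ^ 4))"

lemma gain_moment_const_nonneg: "0 \<le> gain_moment_const"
  using lam by (simp add: gain_moment_const_def)

lemma gain_second_moment:
  assumes "0 \<le> fst s" "0 \<le> snd s"
  shows "(\<integral>\<^sup>+x. ennreal ((gain s x)\<^sup>2) \<partial>packet) \<le> ennreal (gain_moment_const * (1 + (snd s)\<^sup>2))"
proof -
  obtain r v where s: "s = (r, v)" by (cases s)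
  have "(\<integral>\<^sup>+x. ennreal ((gain s x)\<^sup>2) \<partial>packet)
      \<le> (\<integral>\<^sup>+x. ennreal (gain_coeff\<^sup>2 * (2 * (1 + v\<^sup>2))) * ennreal (((1 + fst x)\<^sup>2)\<^sup>2) \<partial>packet)"
  proof (rule nn_integral_mono_AE)
    show "AE x in packet. ennreal ((gain s x)\<^sup>2) \<le> ennreal (gain_coeff\<^sup>2 * (2 * (1 + v\<^sup>2))) * ennreal (((1 + fst x)\<^sup>2)\<^sup>2)"
      using AE_packet
    proof eventually_elim
      case (elim x)
      have "(gain s x)\<^sup>2 = \<bar>gain (r, v) x\<bar>\<^sup>2" by (simp add: s)
      also have "\<dots> \<le> (gain_coeff * ((1 + v) * (1 + fst x)\<^sup>2))\<^sup>2"
        using gain_bound[of r v x] elim assms by (intro power_mono) (auto simp: s)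
      also have "\<dots> = gain_coeff\<^sup>2 * (1 + v)\<^sup>2 * ((1 + fst x)\<^sup>2)\<^sup>2"
        by (simp only: power_mult_distrib mult.assoc)
      also have "\<dots> \<le> gain_coeff\<^sup>2 * (2 * (1 + v\<^sup>2)) * ((1 + fst x)\<^sup>2)\<^sup>2"
      proof -
        have "(1 + v)\<^sup>2 \<le> 2 * (1 + v\<^sup>2)"
          using sum_squares_bound[of 1 v] by (simp add: power2_sum)
        then show ?thesis
          by (intro mult_right_mono mult_left_mono zero_le_power2)
      qed
      finally show ?case
        by (simp add: ennreal_leI flip: ennreal_mult)
    qed
  qed
  also have "\<dots> = ennreal (gain_coeff\<^sup>2 * (2 * (1 + v\<^sup>2))) * (\<integral>\<^sup>+x. ennreal (((1 + fst x)\<^sup>2)\<^sup>2) \<partial>packet)"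
    by (rule nn_integral_cmult) measurable
  also have "\<dots> \<le> ennreal (gain_coeff\<^sup>2 * (2 * (1 + v\<^sup>2))) * ennreal (8 + 8 * (fact 4 / lam ^ 4))"
    by (intro mult_left_mono gap_fourth_moment) auto
  also have "\<dots> = ennreal (gain_moment_const * (1 + (snd s)\<^sup>2))"
  proof -
    have "gain_coeff\<^sup>2 * (2 * (1 + v\<^sup>2)) * (8 + 8 * (fact 4 / lam ^ 4)) = gain_moment_const * (1 + (snd s)\<^sup>2)"
      by (simp add: gain_moment_const_def s)
    then show ?thesis
      using lam by (subst ennreal_mult[symmetric]) auto
  qed
  finally show ?thesis .
qed

section \<open>Strong laws and the average age\<close>

text \<open>Given the state, packet \<open>j\<close> is fresh, so the gains are centered martingale
  differences; the uniform second moment of the age bounds theirs. Nonnegativity of the residual,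
  required for centering, holds almost surely.\<close>

lemma gain_strong_law:
  "AE \<omega> in PiM UNIV (\<lambda>_. packet). (\<lambda>J. (\<Sum>j<J. gain (state k len \<omega> j) (\<omega> j)) / real J) \<longlonglongrightarrow> 0"
proof (rule strong_law_martingale_differences[OF packet.prob_space_axioms, where K="gain_moment_const * (1 + drift_const / drift_rate)"])
  fix j :: nat
  show "(\<lambda>\<omega>. gain (state k len \<omega> j) (\<omega> j)) \<in> borel_measurable (PiM UNIV (\<lambda>_. packet))"
    by measurable
  show "AE \<omega> in PiM UNIV (\<lambda>_. packet). (\<integral>x. gain (state k len (fun_upd \<omega> j x) j) ((fun_upd \<omega> j x) j) \<partial>packet) = 0"
    using AE_state[of j] by eventually_elim (simp add: state_fun_upd gain_centered)
  have "(\<integral>\<^sup>+\<omega>. ennreal ((gain (state k len \<omega> j) (\<omega> j))\<^sup>2) \<partial>PiM UNIV (\<lambda>_. packet))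
      = (\<integral>\<^sup>+\<omega>. \<integral>\<^sup>+x. ennreal ((gain (state k len \<omega> j) x)\<^sup>2) \<partial>packet \<partial>PiM UNIV (\<lambda>_. packet))"
    by (subst nn_integral_resample[OF packet.prob_space_axioms, where j=j]) (simp_all add: state_fun_upd)
  also have "\<dots> \<le> (\<integral>\<^sup>+\<omega>. ennreal gain_moment_const * (1 + ennreal ((snd (state k len \<omega> j))\<^sup>2)) \<partial>PiM UNIV (\<lambda>_. packet))"
  proof (rule nn_integral_mono_AE)
    show "AE \<omega> in PiM UNIV (\<lambda>_. packet). (\<integral>\<^sup>+x. ennreal ((gain (state k len \<omega> j) x)\<^sup>2) \<partial>packet)
        \<le> ennreal gain_moment_const * (1 + ennreal ((snd (state k len \<omega> j))\<^sup>2))"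
      using AE_state[of j]
    proof eventually_elim
      case (elim \<omega>)
      then show ?case
        using gain_second_moment[of "state k len \<omega> j"] gain_moment_const_nonneg
        by (simp add: ennreal_mult ennreal_plus flip: ennreal_1)
    qed
  qed
  also have "\<dots> = ennreal gain_moment_const * (1 + (\<integral>\<^sup>+\<omega>. ennreal ((snd (state k len \<omega> j))\<^sup>2) \<partial>PiM UNIV (\<lambda>_. packet)))"
    by (simp add: nn_integral_cmult nn_integral_add sys.emeasure_space_1)
  also have "\<dots> \<le> ennreal gain_moment_const * (1 + ennreal (drift_const / drift_rate))"
    by (intro mult_left_mono add_left_mono state_second_moment) auto
  also have "\<dots> = ennreal (gain_moment_const * (1 + drift_const / drift_rate))"
    using gain_moment_const_nonneg drift_const_nonneg drift_rate by (simp add: ennreal_mult ennreal_plus flip: ennreal_1)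
  finally show "(\<integral>\<^sup>+\<omega>. ennreal ((gain (state k len \<omega> j) (\<omega> j))\<^sup>2) \<partial>PiM UNIV (\<lambda>_. packet))
      \<le> ennreal (gain_moment_const * (1 + drift_const / drift_rate))" .
qed (simp add: state_fun_upd)

lemma gap_strong_law:
  "AE \<omega> in PiM UNIV (\<lambda>_. packet). (\<lambda>J. (\<Sum>j<J. fst (\<omega> j)) / real J) \<longlonglongrightarrow> 1 / lam"
proof -
  have mean: "has_bochner_integral packet (\<lambda>x. fst x) (1 / lam)"
  proof -
    have "has_bochner_integral packet (idle_moment 0 1 one) (1 / lam)"
      using idle_moment_integral(1)[of 0 1] by simp
    moreover have "AE x in packet. idle_moment 0 1 one x = fst x"
      using AE_packet by eventually_elim (simp add: idle_moment_def one_def)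
    moreover have "fst \<in> borel_measurable packet" by measurable
    ultimately show ?thesis
      using integrable_cong_AE[of "idle_moment 0 1 one" packet fst] integral_cong_AE[of "idle_moment 0 1 one" packet fst]
      by (auto simp: has_bochner_integral_iff)
  qed
  have "AE \<omega> in PiM UNIV (\<lambda>_. packet). (\<lambda>J. (\<Sum>j<J. fst (\<omega> j) - 1 / lam) / real J) \<longlonglongrightarrow> 0"
  proof (rule strong_law_martingale_differences[OF packet.prob_space_axioms, where K="(1 + 1 / lam\<^sup>2) * (8 + 8 * (fact 4 / lam ^ 4))"])
    fix j :: nat
    show "(\<lambda>\<omega>. fst (\<omega> j) - 1 / lam) \<in> borel_measurable (PiM UNIV (\<lambda>_. packet))"
      by measurable
    show "AE \<omega> in PiM UNIV (\<lambda>_. packet). (\<integral>x. fst ((fun_upd \<omega> j x) j) - 1 / lam \<partial>packet) = 0"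
      using mean by (simp add: has_bochner_integral_iff packet.prob_space)
    have "(\<integral>\<^sup>+\<omega>. ennreal ((fst (\<omega> j) - 1 / lam)\<^sup>2) \<partial>PiM UNIV (\<lambda>_. packet))
        = (\<integral>\<^sup>+\<omega>. \<integral>\<^sup>+x. ennreal ((fst x - 1 / lam)\<^sup>2) \<partial>packet \<partial>PiM UNIV (\<lambda>_::nat. packet))"
      by (subst nn_integral_resample[OF packet.prob_space_axioms, where j=j]) simp_all
    also have "\<dots> = (\<integral>\<^sup>+x. ennreal ((fst x - 1 / lam)\<^sup>2) \<partial>packet)"
      by (simp add: sys.emeasure_space_1)
    also have "\<dots> \<le> (\<integral>\<^sup>+x. ennreal (1 + 1 / lam\<^sup>2) * ennreal (((1 + fst x)\<^sup>2)\<^sup>2) \<partial>packet)"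
    proof (rule nn_integral_mono_AE)
      show "AE x in packet. ennreal ((fst x - 1 / lam)\<^sup>2) \<le> ennreal (1 + 1 / lam\<^sup>2) * ennreal (((1 + fst x)\<^sup>2)\<^sup>2)"
        using AE_packet
      proof eventually_elim
        case (elim x)
        define t where "t = fst x"
        have t: "0 \<le> t" using elim by (simp add: t_def)
        \<comment> \<open>The cross term is nonpositive. The crude passage to the fourth power
          afterwards allows reuse of \<open>gap_fourth_moment\<close>.\<close>
        have "(t - 1 / lam)\<^sup>2 \<le> t\<^sup>2 + 1 / lam\<^sup>2"
          using t lam by (simp add: power2_diff power_divide)
        also have "\<dots> \<le> (1 + 1 / lam\<^sup>2) * (1 + t)\<^sup>2"
        proof -
          have "t\<^sup>2 \<le> 1 * (1 + t)\<^sup>2" using t by (auto intro: power_mono)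
          moreover have "1 / lam\<^sup>2 * 1 \<le> 1 / lam\<^sup>2 * (1 + t)\<^sup>2" using t by (intro mult_left_mono) auto
          ultimately show ?thesis by (simp only: distrib_right mult_1_right)
        qed
        also have "\<dots> \<le> (1 + 1 / lam\<^sup>2) * ((1 + t)\<^sup>2)\<^sup>2"
          using t by (intro mult_left_mono self_le_power one_le_power) auto
        finally have "ennreal ((t - 1 / lam)\<^sup>2) \<le> ennreal ((1 + 1 / lam\<^sup>2) * ((1 + t)\<^sup>2)\<^sup>2)"
          by (rule ennreal_leI)
        then show ?case
          by (subst ennreal_mult[symmetric]) (simp_all only: t_def, simp_all)
      qed
    qed
    also have "\<dots> = ennreal (1 + 1 / lam\<^sup>2) * (\<integral>\<^sup>+x. ennreal (((1 + fst x)\<^sup>2)\<^sup>2) \<partial>packet)"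
      by (rule nn_integral_cmult) measurable
    also have "\<dots> \<le> ennreal (1 + 1 / lam\<^sup>2) * ennreal (8 + 8 * (fact 4 / lam ^ 4))"
      by (intro mult_left_mono gap_fourth_moment) auto
    also have "\<dots> = ennreal ((1 + 1 / lam\<^sup>2) * (8 + 8 * (fact 4 / lam ^ 4)))"
      using lam by (subst ennreal_mult[symmetric]) auto
    finally show "(\<integral>\<^sup>+\<omega>. ennreal ((fst (\<omega> j) - 1 / lam)\<^sup>2) \<partial>PiM UNIV (\<lambda>_. packet))
        \<le> ennreal ((1 + 1 / lam\<^sup>2) * (8 + 8 * (fact 4 / lam ^ 4)))" .
  qed simp
  then show ?thesis
  proof eventually_elim
    case (elim \<omega>)
    then have "(\<lambda>J. (\<Sum>j<J. fst (\<omega> j) - 1 / lam) / real J + 1 / lam) \<longlonglongrightarrow> 0 + 1 / lam"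
      by (intro tendsto_intros)
    moreover have "\<forall>\<^sub>F J in sequentially. (\<Sum>j<J. fst (\<omega> j) - 1 / lam) / real J + 1 / lam = (\<Sum>j<J. fst (\<omega> j)) / real J"
      using lam by (intro eventually_sequentiallyI[of 1]) (simp add: sum_subtractf diff_divide_distrib)
    ultimately have "(\<lambda>J. (\<Sum>j<J. fst (\<omega> j)) / real J) \<longlonglongrightarrow> 0 + 1 / lam"
      by (rule Lim_transform_eventually)
    then show ?case by simp
  qed
qed

text \<open>The increments of the clock and of the age telescope, both starting from 0.\<close>

lemma sum_area_incr:
  "(\<Sum>j<J. area_incr k len (state k len \<omega> j) (\<omega> j))
     = (\<Sum>j<J. gain (state k len \<omega> j) (\<omega> j)) + \<Delta> * clock k len \<omega> J - \<gamma> * snd (state k len \<omega> J)"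
  by (induction J) (simp_all add: gain_def clock_Suc algebra_simps)

theorem AE_average_age:
  "AE \<omega> in sys_space lam p \<alpha>. ((\<lambda>T. integral {0..T} (age k len \<omega>) / T) \<longlongrightarrow> \<Delta>) at_top"
  unfolding sys_space_eq
  using AE_sample gain_strong_law gap_strong_law AE_state_sublinear
proof eventually_elim
  case (elim \<omega>)
  have nonneg: "0 \<le> fst (\<omega> j)" for j using elim(1) by blast
  \<comment> \<open>The clock exceeds the last arrival time by the residual, which is bounded and
    vanishes after division by \<open>J\<close>.\<close>
  have res: "(\<lambda>J. fst (state k len \<omega> J) / real J) \<longlonglongrightarrow> 0"
  proof (rule Lim_null_comparison[where g="\<lambda>J. len_bound / real J"])
    show "\<forall>\<^sub>F J in sequentially. norm (fst (state k len \<omega> J) / real J) \<le> len_bound / real J"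
      using state_nonneg[OF nonneg] residual_le_bound[of \<omega>] elim(1)
      by (intro always_eventually allI) (auto intro!: divide_right_mono)
    show "(\<lambda>J. len_bound / real J) \<longlonglongrightarrow> 0" by (rule lim_const_over_n)
  qed
  have clock: "(\<lambda>J. clock k len \<omega> J / real J) \<longlonglongrightarrow> 1 / lam"
    using tendsto_add[OF elim(3) res] by (simp add: clock_def add_divide_distrib)
  \<comment> \<open>Divided by \<open>J\<close>, the gains and the boundary term vanish in the
    limit, and only \<open>\<Delta>\<close> times the clock rate survives.\<close>
  have "(\<lambda>J. (\<Sum>j<J. gain (state k len \<omega> j) (\<omega> j)) / real J + \<Delta> * (clock k len \<omega> J / real J)
      - \<gamma> * (snd (state k len \<omega> J) / real J)) \<longlonglongrightarrow> 0 + \<Delta> * (1 / lam) - \<gamma> * 0"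
    by (intro tendsto_intros elim(2) clock elim(4))
  then have "(\<lambda>J. (\<Sum>j<J. area_incr k len (state k len \<omega> j) (\<omega> j)) / real J) \<longlonglongrightarrow> \<Delta> * (1 / lam)"
    by (simp add: sum_area_incr add_divide_distrib diff_divide_distrib)
  then show ?case
    using lam by (intro average_age_tendsto[OF nonneg clock]) auto
qed

end

text \<open>Some realization has positive probability, hence so has the most likely one, index 1,
  which belongs to the first sum because \<open>1 \<le> k\<close>.\<close>

lemma q_ka_pos:
  assumes supp: "set_pmf p \<subseteq> {1..n}" and "0 \<le> \<alpha>" "1 \<le> k"
    and dec: "\<And>m j. 1 \<le> m \<Longrightarrow> m \<le> j \<Longrightarrow> j \<le> n \<Longrightarrow> pmf p j \<le> pmf p m"
  shows "0 < q_ka p n k \<alpha>"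
proof -
  obtain i where i: "i \<in> set_pmf p" using set_pmf_not_empty[of p] by blast
  then have "0 < pmf p i" by (rule pmf_positive)
  also have "\<dots> \<le> pmf p 1" using supp i dec[of 1 i] by auto
  also have "\<dots> \<le> (\<Sum>i=1..k. pmf p i)" using \<open>1 \<le> k\<close> by (intro member_le_sum) auto
  also have "\<dots> \<le> q_ka p n k \<alpha>"
    using \<open>0 \<le> \<alpha>\<close> by (simp add: q_ka_def sum_nonneg)
  finally show ?thesis .
qed

theorem theorem2:
  fixes lam \<alpha> :: real and p :: "nat pmf" and n k :: nat and len :: "nat \<Rightarrow> nat"
  assumes "lam > 0"
    and "0 \<le> \<alpha>" "\<alpha> \<le> 1"
    and "set_pmf p \<subseteq> {1..n}"
    and "\<And>m j. 1 \<le> m \<Longrightarrow> m \<le> j \<Longrightarrow> j \<le> n \<Longrightarrow> pmf p j \<le> pmf p m"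
    and "1 \<le> k" "k \<le> n"
  shows "AE \<omega> in sys_space lam p \<alpha>.
     ((\<lambda>T. integral {0..T} (age k len \<omega>) / T) \<longlongrightarrow>
        (let q = q_ka p n k \<alpha>; a = EL p n k \<alpha> len; b = EL2 p n k \<alpha> len in
          (b + 2 / (q * lam) * a + 2 / (q * lam)^2) / (2 * (a + 1 / (q * lam))) + a)) at_top"
proof -
  interpret selective_encoding lam \<alpha> p n k len
    using assms q_ka_pos[OF assms(4,2,6,5)] by unfold_locales auto
  show ?thesis
    using AE_average_age unfolding \<Delta>_eq Let_def .
qed

end
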